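(* If $\mu$ is a $T$-invariant probability measure on $M$ with periodic repetitive pattern, then its measure-theoretic entropy satisfies $h_{\mu}(T)=0$.
   Context: Setting: fix $k\in\mathbb{N}$ and $C^1$ diffeomorphisms $f_1,\dots,f_k:\mathbb{S}^1\to\mathbb{S}^1$. Let $\Sigma_k=\{1,\dots,k\}^{\mathbb{Z}}$ with the product topology, $\sigma:\Sigma_k\to\Sigma_k$ the shift map, $M=\Sigma_k\times\mathbb{S}^1$, and let $T:M\to M$ be the locally constant skew product $T(\xi,x)=(\sigma(\xi),f_{\omega_0}(x))$ for $\xi=(\omega_j)_{j\in\mathbb{Z}}$. A point $\xi\in\Sigma_k$ is generated by a finite word $\omega_1\dots\omega_{\pi}$ if it is the bi-infinite periodic repetition of that word, positioned so that coordinate $j$ of $\xi$ is $\omega_{j+1}$ for $0\le j\le \pi-1$. $O(x)$ denotes the $T$-orbit of $x$. For an interval $J\subset\mathbb{S}^1$, $|J|$ is its length. Definition (repetitive pattern). A sequence $X_n=O((\xi_n,q_n))$, $n\ge 0$, of $T$-periodic orbits, where $\xi_n\in\Sigma_k$ is generated by the finite word $\omega^n_1\dots\omega^n_{\pi_n}$, has a repetitive pattern if: (1) There is a nested sequence of intervals $J_{n+1}\subset J_n\subset\mathbb{S}^1$ with $q_n\in J_n$, $0<|J_{n+1}|<|J_n|$ for every $n$, and $|J_n|\to 0$. (2) The intervals $J_0$ and $f_{\omega^0_\ell}\circ\dots\circ f_{\omega^0_1}(J_0)$, $\ell=1,\dots,\pi_0-1$, are pairwise disjoint. (3) For each $n\ge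 0$, the map $g_n=f_{\omega^n_{\pi_n}}\circ\dots\circ f_{\omega^n_1}$ satisfies $g_n(q_n)=q_n$ and $|g_n'|<1$ on $J_n$. Moreover, for each $n\ge 1$ there exist an integer $R_n\ge1$, a map $T_{R_n}$ which is a composition of $R_n$ maps from $\{f_1,\dots,f_k\}$, and an integer $k_n\ge 2$ such that $g_n=T_{R_n}\circ g_{n-1}^{k_n}$. This equality is understood at the level of words: the word $\omega^n_1\dots\omega^n_{\pi_n}$ is $k_n$ consecutive copies of $\omega^{n-1}_1\dots\omega^{n-1}_{\pi_{n-1}}$ followed by a word $\alpha_n$ of length $R_n$ (the word defining $T_{R_n}$); in particular $\pi_n=k_n\pi_{n-1}+R_n$. (4) The sequence $\lambda_n=\frac{R_n}{k_n\pi_{n-1}}$, $n\ge1$, is summable. Definition (measure with periodic repetitive pattern). A probability measure $\mu$ on $M$ has periodic repetitive pattern if there is a sequence $X_n=O((\xi_n,q_n))$ of $T$-periodic orbits with repetitive pattern such that the measures $\mu_{X_n}=\frac1{\pi_n}\sum_{\ell=0}^{\pi_n-1}\delta_{T^\ell(\xi_n,q_n)}$ converge to $\mu$ in the weak-star topology. *)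

theory Defs
  imports "HOL-Probability.Probability"
begin

section \<open>The circle\<close>

text \<open>
  The circle is the unit circle in the complex plane, with \<^const>\<open>cis\<close> as its arc length
  parametrization; its total length is therefore \<open>2 * pi\<close>.
\<close>

abbreviation circle :: "complex set" where
  "circle \<equiv> sphere 0 1"

definition circle_C1_diffeo :: "(complex \<Rightarrow> complex) \<Rightarrow> bool" where
  "circle_C1_diffeo h \<longleftrightarrow>
     bij_betw h circle circle \<and>
     (\<lambda>t. h (cis t)) C1_differentiable_on UNIV \<and>
     (\<lambda>t. inv_into circle h (cis t)) C1_differentiable_on UNIV"

text \<open>
  The modulus \<open>|h'(z)|\<close> of the derivative of a circle map: the speed of \<open>h \<circ> cis\<close> at an argument
  of \<open>z\<close>. By periodicity any other argument gives the same value.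
\<close>

definition circle_abs_deriv :: "(complex \<Rightarrow> complex) \<Rightarrow> complex \<Rightarrow> real" where
  "circle_abs_deriv h z = norm (vector_derivative (\<lambda>t. h (cis t)) (at (Arg z)))"

text \<open>
  An interval may be open, closed or half-open; the proper connected subsets of the circle are
  exactly these (and the degenerate cases, of length 0).
\<close>

definition circle_interval :: "complex set \<Rightarrow> bool" where
  "circle_interval J \<longleftrightarrow> connected J \<and> J \<subset> circle"

definition circle_length :: "complex set \<Rightarrow> real" where
  "circle_length J = measure lborel {t \<in> {0..<2 * pi}. cis t \<in> J}"


section \<open>The skew product\<close>

definition full_shift :: "nat \<Rightarrow> (int \<Rightarrow> nat) set" where
  "full_shift k = {\<xi>. \<forall>j. \<xi> j \<in> {1..k}}"

text \<open>
  The type class topology on \<^typ>\<open>int \<Rightarrow> nat\<close> is the product topology with discrete factors, so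
  that the full shift carries the intended topology as a subspace.
\<close>

lemma full_shift_topology:
  "top_of_set (full_shift k) = product_topology (\<lambda>_. discrete_topology {1..k}) UNIV"
proof -
  have *: "full_shift k = (\<Pi>\<^sub>E j\<in>(UNIV::int set). {1..k})"
    by (auto simp: full_shift_def PiE_def)
  have "t1_space (euclidean :: nat topology)"
    by (simp add: t1_space_closedin_singleton flip: closed_closedin)
  then have d: "top_of_set {1..k} = discrete_topology {1..k}"
    by (rule subtopology_eq_discrete_topology_finite) simp_all
  have "top_of_set (full_shift k) =
      subtopology (product_topology (\<lambda>_::int. euclidean) UNIV) (\<Pi>\<^sub>E j\<in>UNIV. {1..k})"
    by (simp only: * euclidean_product_topology)
  also have "\<dots> = product_topology (\<lambda>_. top_of_set {1..k}) UNIV"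
    by (rule subtopology_product_topology)
  finally show ?thesis
    by (simp only: d)
qed

definition shift_map :: "(int \<Rightarrow> nat) \<Rightarrow> int \<Rightarrow> nat" where
  "shift_map \<xi> = (\<lambda>j. \<xi> (j + 1))"

definition skew_space :: "nat \<Rightarrow> ((int \<Rightarrow> nat) \<times> complex) set" where
  "skew_space k = full_shift k \<times> circle"

definition skew_borel :: "nat \<Rightarrow> ((int \<Rightarrow> nat) \<times> complex) measure" where
  "skew_borel k = restrict_space borel (skew_space k)"

definition skew_map ::
  "(nat \<Rightarrow> complex \<Rightarrow> complex) \<Rightarrow> (int \<Rightarrow> nat) \<times> complex \<Rightarrow> (int \<Rightarrow> nat) \<times> complex" where
  "skew_map f = (\<lambda>(\<xi>, x). (shift_map \<xi>, f (\<xi> 0) x))"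


section \<open>Repetitive patterns\<close>

definition generated_by :: "nat list \<Rightarrow> int \<Rightarrow> nat" where
  "generated_by w = (\<lambda>j. w ! nat (j mod int (length w)))"

text \<open>
  The orbit \<open>X\<^sub>n\<close> is given by its base point \<open>(\<xi> n, q n)\<close>, and \<open>\<pi>\<^sub>n\<close> is \<open>length (w n)\<close> for the
  generating word \<open>w n\<close>. For a word \<open>[a\<^sub>1, \<dots>, a\<^sub>l]\<close> the map \<open>fold f [a\<^sub>1, \<dots>, a\<^sub>l]\<close> is
  \<open>f a\<^sub>l \<circ> \<dots> \<circ> f a\<^sub>1\<close>, so \<open>fold f (w n)\<close> is \<open>g\<^sub>n\<close>.
  The data \<open>k\<^sub>n\<close>, \<open>\<alpha>\<^sub>n\<close> and \<open>R\<^sub>n = length \<alpha>\<^sub>n\<close> only occur for \<open>n \<ge> 1\<close>, hence at \<open>Suc n\<close>.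
\<close>

definition repetitive_pattern ::
  "nat \<Rightarrow> (nat \<Rightarrow> complex \<Rightarrow> complex) \<Rightarrow> (nat \<Rightarrow> int \<Rightarrow> nat) \<Rightarrow> (nat \<Rightarrow> complex) \<Rightarrow>
   (nat \<Rightarrow> nat list) \<Rightarrow> bool" where
  "repetitive_pattern k f \<xi> q w \<longleftrightarrow>
     (\<forall>n. (\<xi> n, q n) \<in> skew_space k \<and>
          (\<exists>p>0. (skew_map f ^^ p) (\<xi> n, q n) = (\<xi> n, q n)) \<and>
          w n \<noteq> [] \<and> set (w n) \<subseteq> {1..k} \<and> \<xi> n = generated_by (w n)) \<and>
     (\<exists>(J :: nat \<Rightarrow> complex set) (\<kappa> :: nat \<Rightarrow> nat) (\<alpha> :: nat \<Rightarrow> nat list).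
        (\<forall>n. circle_interval (J n) \<and> q n \<in> J n \<and> J (Suc n) \<subseteq> J n \<and>
             0 < circle_length (J (Suc n)) \<and> circle_length (J (Suc n)) < circle_length (J n)) \<and>
        (\<lambda>n. circle_length (J n)) \<longlonglongrightarrow> 0 \<and>
        disjoint_family_on (\<lambda>l. fold f (take l (w 0)) ` J 0) {..<length (w 0)} \<and>
        (\<forall>n. fold f (w n) (q n) = q n \<and>
             (\<forall>z\<in>J n. circle_abs_deriv (fold f (w n)) z < 1)) \<and>
        (\<forall>n. 1 \<le> length (\<alpha> (Suc n)) \<and> 2 \<le> \<kappa> (Suc n) \<and>
             w (Suc n) = concat (replicate (\<kappa> (Suc n)) (w n)) @ \<alpha> (Suc n)) \<and>
        summable (\<lambda>n. real (length (\<alpha> (Suc n))) / (real (\<kappa> (Suc n)) * real (length (w n)))))"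

text \<open>
  The measure \<open>1/p * (\<Sum>l<p. \<delta>(T\<^sup>l x))\<close>, as the image of the uniform distribution on \<open>{..<p}\<close>.
\<close>

definition orbit_measure :: "'a measure \<Rightarrow> ('a \<Rightarrow> 'a) \<Rightarrow> 'a \<Rightarrow> nat \<Rightarrow> 'a measure" where
  "orbit_measure N T x p = distr (uniform_count_measure {..<p}) N (\<lambda>l. (T ^^ l) x)"

lemma measure_orbit_measure:
  assumes "\<And>l. l < p \<Longrightarrow> (T ^^ l) x \<in> space N" and "A \<in> sets N"
  shows "measure (orbit_measure N T x p) A = 1 / real p * (\<Sum>l<p. indicator A ((T ^^ l) x))"
proof -
  have "(\<lambda>l. (T ^^ l) x) \<in> uniform_count_measure {..<p} \<rightarrow>\<^sub>M N"
    using assms(1) by (auto simp: measurable_def space_uniform_count_measure sets_uniform_count_measure)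
  then have "measure (orbit_measure N T x p) A =
      measure (uniform_count_measure {..<p}) ((\<lambda>l. (T ^^ l) x) -` A \<inter> {..<p})"
    unfolding orbit_measure_def using assms(2)
    by (simp add: measure_distr space_uniform_count_measure)
  also have "\<dots> = real (card ((\<lambda>l. (T ^^ l) x) -` A \<inter> {..<p})) / real p"
    by (simp add: measure_uniform_count_measure)
  also have "(\<lambda>l. (T ^^ l) x) -` A \<inter> {..<p} = {l \<in> {..<p}. (T ^^ l) x \<in> A}"
    by auto
  also have "real (card {l \<in> {..<p}. (T ^^ l) x \<in> A}) = (\<Sum>l<p. indicator A ((T ^^ l) x))"
    unfolding indicator_def by (simp add: sum.If_cases Int_def)
  finally show ?thesis by simp
qed

text \<open>
  Weak-star convergence on a compact space: all continuous test functions are bounded there.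
\<close>

definition weak_star_convergent ::
  "'a::topological_space set \<Rightarrow> (nat \<Rightarrow> 'a measure) \<Rightarrow> 'a measure \<Rightarrow> bool" where
  "weak_star_convergent S \<nu> \<mu> \<longleftrightarrow>
     (\<forall>\<phi> :: 'a \<Rightarrow> real. continuous_on S \<phi> \<longrightarrow>
        (\<lambda>n. integral\<^sup>L (\<nu> n) \<phi>) \<longlonglongrightarrow> integral\<^sup>L \<mu> \<phi>)"

definition periodic_repetitive_pattern ::
  "nat \<Rightarrow> (nat \<Rightarrow> complex \<Rightarrow> complex) \<Rightarrow> ((int \<Rightarrow> nat) \<times> complex) measure \<Rightarrow> bool" where
  "periodic_repetitive_pattern k f \<mu> \<longleftrightarrow>
     (\<exists>\<xi> q w. repetitive_pattern k f \<xi> q w \<and>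
        weak_star_convergent (skew_space k)
          (\<lambda>n. orbit_measure (skew_borel k) (skew_map f) (\<xi> n, q n) (length (w n))) \<mu>)"


section \<open>Measure-theoretic entropy\<close>

definition invariant_measure :: "('a \<Rightarrow> 'a) \<Rightarrow> 'a measure \<Rightarrow> bool" where
  "invariant_measure T \<mu> \<longleftrightarrow> T \<in> \<mu> \<rightarrow>\<^sub>M \<mu> \<and> distr \<mu> \<mu> T = \<mu>"

definition finite_measurable_partition :: "'a measure \<Rightarrow> 'a set set \<Rightarrow> bool" where
  "finite_measurable_partition \<mu> P \<longleftrightarrow> finite P \<and> P \<subseteq> sets \<mu> \<and> partition_on (space \<mu>) P"

text \<open>The join of the partitions \<open>T\<^sup>-\<^sup>iP\<close>, \<open>i < n\<close>, consists of the nonempty intersections.\<close>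

definition dynamical_join :: "'a measure \<Rightarrow> ('a \<Rightarrow> 'a) \<Rightarrow> 'a set set \<Rightarrow> nat \<Rightarrow> 'a set set" where
  "dynamical_join \<mu> T P n =
     {{x \<in> space \<mu>. \<forall>i<n. (T ^^ i) x \<in> A i} | A. \<forall>i<n. A i \<in> P} - {{}}"

text \<open>The convention \<open>0 ln 0 = 0\<close> is automatic here.\<close>

definition partition_entropy :: "'a measure \<Rightarrow> 'a set set \<Rightarrow> real" where
  "partition_entropy \<mu> P = - (\<Sum>A\<in>P. measure \<mu> A * ln (measure \<mu> A))"

text \<open>
  For invariant probability measures and finite measurable partitions the following limit exists
  by subadditivity.
\<close>

definition entropy_wrt_partition :: "'a measure \<Rightarrow> ('a \<Rightarrow> 'a) \<Rightarrow> 'a set set \<Rightarrow> real" where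
  "entropy_wrt_partition \<mu> T P =
     lim (\<lambda>n. partition_entropy \<mu> (dynamical_join \<mu> T P n) / real n)"

definition ks_entropy :: "'a measure \<Rightarrow> ('a \<Rightarrow> 'a) \<Rightarrow> ereal" where
  "ks_entropy \<mu> T =
     (SUP P\<in>{P. finite_measurable_partition \<mu> P}. ereal (entropy_wrt_partition \<mu> T P))"

end

theory Submission
  imports Defs
begin

text \<open>
  Entropy is bounded by code lengths: by Gibbs' inequality, any subprobability \<open>Q\<close> on the itineraries
  of length \<open>N\<close> of a partition satisfies \<open>H \<le> E[- ln Q]\<close>. Call a finite labelling cheap if for every
  \<open>\<epsilon> > 0\<close> and all large \<open>N\<close> there is a \<open>Q\<close> with \<open>E[- ln Q] \<le> \<epsilon> N\<close>. Product codes and independent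
  codes for small differences show that the cheap events form a \<open>\<sigma>\<close>-algebra (the Pinsker algebra),
  so it suffices that the generators \<open>\<xi>\<^sub>j = a\<close>, \<open>Re x \<le> a\<close> and \<open>Im x \<le> a\<close> are cheap.

  A long window of the periodic word \<open>w\<^sub>m\<close> consists of copies of \<open>w\<^sub>n\<close> up to a proportion
  \<open>\<Sum>\<^sub>i\<^sub>>\<^sub>n \<lambda>\<^sub>i\<close> of other letters. Charging \<open>ln 2\<close> per copy and a constant per other letter gives
  \<open>E[- ln Q] \<le> \<epsilon> N\<close> on all the periodic orbits with \<open>m \<ge> n\<close>, for \<open>n\<close> large, and this passes to the
  weak-star limit \<open>\<mu>\<close>. Given the word, the circle homeomorphisms cut the circle into only \<open>O(N)\<close>
  arcs on which the itinerary of a half plane is constant, so the fibre costs \<open>O(ln N)\<close>.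
\<close>

section \<open>Codes for itineraries\<close>

definition itinerary :: "('a \<Rightarrow> 'a) \<Rightarrow> ('a \<Rightarrow> 'b) \<Rightarrow> nat \<Rightarrow> 'a \<Rightarrow> 'b list" where
  "itinerary T \<phi> N x = map (\<lambda>i. \<phi> ((T ^^ i) x)) [0..<N]"

lemma length_itinerary [simp]: "length (itinerary T \<phi> N x) = N"
  by (simp add: itinerary_def)

lemma itinerary_comp: "itinerary T (\<lambda>x. g (\<phi> x)) N x = map g (itinerary T \<phi> N x)"
  by (simp add: itinerary_def)

lemma itinerary_Suc: "itinerary T \<phi> (Suc N) x = itinerary T \<phi> N x @ [\<phi> ((T ^^ N) x)]"
  by (simp add: itinerary_def)

lemma itinerary_shift: "itinerary T (\<lambda>x. \<phi> (T x)) N x = itinerary T \<phi> N (T x)"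
  by (simp add: itinerary_def funpow_swap1)

text \<open>Termwise \<open>ln y \<le> y - 1\<close> at \<open>y = Q u / p u\<close>, multiplied by
  \<open>p u\<close> and summed. Terms with \<open>p u = 0\<close> vanish on the left and need only
  \<open>0 < Q u\<close>.\<close>

lemma gibbs_inequality:
  fixes p Q :: "'b \<Rightarrow> real"
  assumes p: "\<And>u. u \<in> S \<Longrightarrow> 0 \<le> p u" "sum p S = 1"
    and Q: "\<And>u. u \<in> S \<Longrightarrow> 0 < Q u" "sum Q S \<le> 1"
  shows "- (\<Sum>u\<in>S. p u * ln (p u)) \<le> (\<Sum>u\<in>S. p u * - ln (Q u))"
proof -
  have "p u * - ln (p u) - p u * - ln (Q u) \<le> Q u - p u" if u: "u \<in> S" for u
  proof (cases "p u = 0")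
    case False
    then have pos: "0 < p u" using p(1)[OF u] by simp
    have "ln (Q u / p u) \<le> Q u / p u - 1"
      using Q(1)[OF u] pos by (intro ln_le_minus_one) simp
    then have "p u * ln (Q u / p u) \<le> p u * (Q u / p u - 1)"
      using pos by (intro mult_left_mono) auto
    then show ?thesis
      using pos Q(1)[OF u] by (simp add: ln_div algebra_simps)
  qed (use Q(1)[OF u] in simp)
  then have "(\<Sum>u\<in>S. p u * - ln (p u) - p u * - ln (Q u)) \<le> (\<Sum>u\<in>S. Q u - p u)"
    by (rule sum_mono)
  then show ?thesis
    using p(2) Q(2) by (simp add: sum_subtractf sum_negf)
qed

text \<open>Surjectivity ensures that shifting a labelling does not change the set of its realised
  itineraries; invariance does the same for their distribution.\<close>

locale measure_preserving_surjection = prob_space M for M :: "'a measure" +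
  fixes T :: "'a \<Rightarrow> 'a"
  assumes T_measurable [measurable]: "T \<in> M \<rightarrow>\<^sub>M M"
    and T_invariant: "distr M M T = M"
    and T_surj: "T ` space M = space M"
begin

abbreviation itins :: "('a \<Rightarrow> 'b) \<Rightarrow> nat \<Rightarrow> 'b list set" where
  "itins \<phi> N \<equiv> itinerary T \<phi> N ` space M"

text \<open>\<open>Q\<close> stands for a code with lengths \<open>- ln Q\<close> (in nats), and
  \<open>sum Q \<le> 1\<close> is Kraft's inequality. Only itineraries realised by a point count;
  positivity on them keeps \<open>ln\<close> away from its default value at 0.\<close>

definition codable_at :: "('a \<Rightarrow> 'b) \<Rightarrow> nat \<Rightarrow> real \<Rightarrow> bool" where
  "codable_at \<phi> N r \<longleftrightarrow>
     (\<exists>Q. (\<forall>u\<in>itins \<phi> N. 0 < Q u) \<and> sum Q (itins \<phi> N) \<le> 1 \<and>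
          (\<integral>x. - ln (Q (itinerary T \<phi> N x)) \<partial>M) \<le> r)"

definition codable :: "('a \<Rightarrow> 'b) \<Rightarrow> real \<Rightarrow> bool" where
  "codable \<phi> \<epsilon> \<longleftrightarrow> simple_function M \<phi> \<and> (\<forall>\<^sub>F N in sequentially. codable_at \<phi> N (\<epsilon> * N))"

lemma T_pow_space: "x \<in> space M \<Longrightarrow> (T ^^ i) x \<in> space M"
  using T_surj by (induction i) auto

lemma T_pow_measurable: "(T ^^ i) \<in> M \<rightarrow>\<^sub>M M"
  by (rule measurable_compose_n) (rule T_measurable)

lemma distr_T_pow: "distr M M (T ^^ i) = M"
proof (induction i)
  case 0
  then show ?case by (simp add: distr_id)
next
  case (Suc i)
  have "distr M M (T ^^ Suc i) = distr (distr M M (T ^^ i)) M T"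
    by (simp only: distr_distr[OF T_measurable T_pow_measurable] funpow.simps)
  then show ?case by (simp add: Suc.IH T_invariant comp_def)
qed

lemma simple_function_itinerary:
  assumes "simple_function M \<phi>"
  shows "simple_function M (itinerary T \<phi> N)"
proof (induction N)
  case 0
  then show ?case by (simp add: itinerary_def)
next
  case (Suc N)
  have "simple_function M (\<lambda>x. \<phi> ((T ^^ N) x))"
    by (rule simple_function_comp[OF T_pow_measurable assms])
  then have "simple_function M (\<lambda>x. itinerary T \<phi> N x @ [\<phi> ((T ^^ N) x)])"
    by (rule simple_function_compose2[where h="\<lambda>u b. u @ [b]", OF Suc.IH])
  then show ?case by (simp only: itinerary_Suc)
qed

lemma finite_itins: "simple_function M \<phi> \<Longrightarrow> finite (itins \<phi> N)"
  by (rule simple_functionD(1)[OF simple_function_itinerary])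

lemma integrable_itinerary:
  fixes F :: "'b list \<Rightarrow> real"
  assumes "simple_function M \<phi>"
  shows "integrable M (\<lambda>x. F (itinerary T \<phi> N x))"
proof (rule integrable_simple_function)
  show "simple_function M (\<lambda>x. F (itinerary T \<phi> N x))"
    by (rule simple_function_compose1[where g=F, OF simple_function_itinerary[OF assms]])
qed simp

lemma integral_itinerary:
  fixes F :: "'b list \<Rightarrow> real"
  assumes "simple_function M \<phi>"
  shows "(\<integral>x. F (itinerary T \<phi> N x) \<partial>M) =
    (\<Sum>u\<in>itins \<phi> N. prob {x \<in> space M. itinerary T \<phi> N x = u} * F u)"
proof -
  let ?A = "\<lambda>u. {x \<in> space M. itinerary T \<phi> N x = u}"
  have m: "?A u \<in> events" for u
    using simple_functionD(2)[OF simple_function_itinerary[OF assms], of N "{u}"]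
    by (simp add: vimage_def Int_def conj_commute)
  have "(\<integral>x. F (itinerary T \<phi> N x) \<partial>M) = (\<integral>x. (\<Sum>u\<in>itins \<phi> N. indicator (?A u) x * F u) \<partial>M)"
  proof (rule Bochner_Integration.integral_cong)
    fix x assume x: "x \<in> space M"
    have "(\<Sum>u\<in>itins \<phi> N. indicator (?A u) x * F u) =
        (\<Sum>u\<in>itins \<phi> N. if u = itinerary T \<phi> N x then F u else 0)"
      using x by (intro sum.cong) (auto simp: indicator_def)
    also have "\<dots> = F (itinerary T \<phi> N x)"
      using x by (simp add: sum.delta[OF finite_itins[OF assms]])
    finally show "F (itinerary T \<phi> N x) = (\<Sum>u\<in>itins \<phi> N. indicator (?A u) x * F u)" by simp
  qed simp
  also have "\<dots> = (\<Sum>u\<in>itins \<phi> N. \<integral>x. indicator (?A u) x * F u \<partial>M)"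
    by (rule Bochner_Integration.integral_sum) (auto intro!: integrable_mult_left integrable_real_indicator m emeasure_finite simp: less_top[symmetric])
  also have "\<dots> = (\<Sum>u\<in>itins \<phi> N. prob (?A u) * F u)"
    using m by (intro sum.cong refl) (simp add: Int_absorb2 subset_eq)
  finally show ?thesis .
qed

section \<open>Operations on codes: relabelling, pairing, shift\<close>

lemma codable_atI:
  assumes "\<And>x. x \<in> space M \<Longrightarrow> 0 < Q (itinerary T \<phi> N x)"
    and "sum Q (itins \<phi> N) \<le> 1"
    and "(\<integral>x. - ln (Q (itinerary T \<phi> N x)) \<partial>M) \<le> r"
  shows "codable_at \<phi> N r"
  using assms unfolding codable_at_def by blast

text \<open>Push \<open>Q\<close> forward: a relabelled itinerary gets the total weight of its
  preimages. The total mass is unchanged, and each weight is at least that of any single preimage,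
  so the cost cannot grow.\<close>

lemma codable_at_comp:
  assumes sf: "simple_function M \<phi>" and c: "codable_at \<phi> N r"
  shows "codable_at (\<lambda>x. g (\<phi> x)) N r"
proof -
  obtain Q where Q: "\<And>u. u \<in> itins \<phi> N \<Longrightarrow> 0 < Q u" "sum Q (itins \<phi> N) \<le> 1"
    "(\<integral>x. - ln (Q (itinerary T \<phi> N x)) \<partial>M) \<le> r"
    using c unfolding codable_at_def by blast
  define Q' where "Q' v = (\<Sum>u | u \<in> itins \<phi> N \<and> map g u = v. Q u)" for v
  note fin = finite_itins[OF sf]
  have le: "Q u \<le> Q' (map g u)" if "u \<in> itins \<phi> N" for u
    unfolding Q'_def using that Q(1) fin by (intro member_le_sum) (auto intro: less_imp_le)
  have im: "itins (\<lambda>x. g (\<phi> x)) N = map g ` itins \<phi> N"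
    unfolding itinerary_comp by (simp only: image_image)
  show ?thesis
  proof (rule codable_atI[where Q=Q'])
    show "0 < Q' (itinerary T (\<lambda>x. g (\<phi> x)) N x)" if "x \<in> space M" for x
      using le[of "itinerary T \<phi> N x"] Q(1)[of "itinerary T \<phi> N x"] that
      by (force simp: itinerary_comp)
    show "sum Q' (itins (\<lambda>x. g (\<phi> x)) N) \<le> 1"
      using Q(2) unfolding im Q'_def sum.image_gen[OF fin, where h=Q and g="map g"] .
    have "(\<integral>x. - ln (Q' (itinerary T (\<lambda>x. g (\<phi> x)) N x)) \<partial>M) \<le> (\<integral>x. - ln (Q (itinerary T \<phi> N x)) \<partial>M)"
      unfolding itinerary_comp
    proof (rule integral_mono)
      show "- ln (Q' (map g (itinerary T \<phi> N x))) \<le> - ln (Q (itinerary T \<phi> N x))"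
        if "x \<in> space M" for x
        using le[of "itinerary T \<phi> N x"] Q(1)[of "itinerary T \<phi> N x"] that by force
    qed (rule integrable_itinerary[where F="\<lambda>u. - ln (Q' (map g u))", OF sf]
        integrable_itinerary[where F="\<lambda>u. - ln (Q u)", OF sf])+
    then show "(\<integral>x. - ln (Q' (itinerary T (\<lambda>x. g (\<phi> x)) N x)) \<partial>M) \<le> r"
      using Q(3) by linarith
  qed
qed

lemma codable_comp: "codable \<phi> \<epsilon> \<Longrightarrow> codable (\<lambda>x. g (\<phi> x)) \<epsilon>"
  unfolding codable_def
  by (auto intro: simple_function_compose1 codable_at_comp elim: eventually_mono)

text \<open>The product weight: logarithms add, and the realised pairs of itineraries form a subset
  of the product set, so the mass stays at most 1.\<close>

lemma codable_at_Pair: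
  assumes sf: "simple_function M \<phi>" "simple_function M \<psi>"
    and c: "codable_at \<phi> N r" "codable_at \<psi> N s"
  shows "codable_at (\<lambda>x. (\<phi> x, \<psi> x)) N (r + s)"
proof -
  obtain Q where Q: "\<And>u. u \<in> itins \<phi> N \<Longrightarrow> 0 < Q u" "sum Q (itins \<phi> N) \<le> 1"
    "(\<integral>x. - ln (Q (itinerary T \<phi> N x)) \<partial>M) \<le> r"
    using c(1) unfolding codable_at_def by blast
  obtain R where R: "\<And>u. u \<in> itins \<psi> N \<Longrightarrow> 0 < R u" "sum R (itins \<psi> N) \<le> 1"
    "(\<integral>x. - ln (R (itinerary T \<psi> N x)) \<partial>M) \<le> s"
    using c(2) unfolding codable_at_def by blast
  let ?\<theta> = "\<lambda>x. (\<phi> x, \<psi> x)"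
  let ?P = "\<lambda>u. Q (map fst u) * R (map snd u)"
  have fst: "map fst (itinerary T ?\<theta> N x) = itinerary T \<phi> N x"
    and snd: "map snd (itinerary T ?\<theta> N x) = itinerary T \<psi> N x" for x
    by (simp_all add: itinerary_def)
  have pos: "0 < Q (itinerary T \<phi> N x)" "0 < R (itinerary T \<psi> N x)" if "x \<in> space M" for x
    using that Q(1) R(1) by auto
  show ?thesis
  proof (rule codable_atI[where Q="?P"])
    show "0 < ?P (itinerary T ?\<theta> N x)" if "x \<in> space M" for x
      using pos[OF that] by (simp add: fst snd)
    let ?i = "\<lambda>u. (map fst u, map snd u)"
    have inj: "inj_on ?i (itins ?\<theta> N)"
      by (rule inj_onI) (metis Pair_inject zip_map_fst_snd)
    have "sum ?P (itins ?\<theta> N) = (\<Sum>(a, b)\<in>?i ` itins ?\<theta> N. Q a * R b)"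
      by (simp add: sum.reindex[OF inj] comp_def)
    also have "\<dots> \<le> (\<Sum>(a, b)\<in>itins \<phi> N \<times> itins \<psi> N. Q a * R b)"
    proof (rule sum_mono2)
      show "finite (itins \<phi> N \<times> itins \<psi> N)"
        using sf by (simp add: finite_itins)
      show "?i ` itins ?\<theta> N \<subseteq> itins \<phi> N \<times> itins \<psi> N"
        by (auto simp: fst snd)
    qed (use Q(1) R(1) in \<open>auto intro!: mult_nonneg_nonneg intro: less_imp_le\<close>)
    also have "\<dots> = sum Q (itins \<phi> N) * sum R (itins \<psi> N)"
      by (simp add: sum_product sum.cartesian_product)
    also have "\<dots> \<le> 1 * 1"
      using Q R by (intro mult_mono sum_nonneg) (auto intro: less_imp_le)
    finally show "sum ?P (itins ?\<theta> N) \<le> 1" by simp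
    have "(\<integral>x. - ln (?P (itinerary T ?\<theta> N x)) \<partial>M) =
        (\<integral>x. - ln (Q (itinerary T \<phi> N x)) + - ln (R (itinerary T \<psi> N x)) \<partial>M)"
      using pos by (intro Bochner_Integration.integral_cong refl) (force simp: fst snd ln_mult)
    also have "\<dots> = (\<integral>x. - ln (Q (itinerary T \<phi> N x)) \<partial>M) + (\<integral>x. - ln (R (itinerary T \<psi> N x)) \<partial>M)"
      by (rule Bochner_Integration.integral_add)
        (rule integrable_itinerary[where F="\<lambda>u. - ln (Q u)", OF sf(1)]
          integrable_itinerary[where F="\<lambda>u. - ln (R u)", OF sf(2)])+
    finally show "(\<integral>x. - ln (?P (itinerary T ?\<theta> N x)) \<partial>M) \<le> r + s"
      using Q(3) R(3) by linarith
  qed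
qed

lemma codable_Pair:
  assumes "codable \<phi> \<epsilon>" "codable \<psi> \<delta>"
  shows "codable (\<lambda>x. (\<phi> x, \<psi> x)) (\<epsilon> + \<delta>)"
proof -
  have "\<forall>\<^sub>F N in sequentially. codable_at \<phi> N (\<epsilon> * N) \<and> codable_at \<psi> N (\<delta> * N)"
    using assms by (auto simp: codable_def eventually_conj_iff)
  then have "\<forall>\<^sub>F N in sequentially. codable_at (\<lambda>x. (\<phi> x, \<psi> x)) N ((\<epsilon> + \<delta>) * N)"
    by (rule eventually_mono)
      (use assms in \<open>auto simp: codable_def distrib_right intro: codable_at_Pair\<close>)
  then show ?thesis
    using assms by (auto simp: codable_def)
qed

text \<open>Since \<open>T\<close> is onto, both labellings realise the same itineraries, and since
  \<open>M\<close> is invariant, these have the same distribution. The equivalence serves to move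
  coordinates both forwards and backwards.\<close>

lemma codable_shift:
  assumes sf: "simple_function M \<phi>"
  shows "codable (\<lambda>x. \<phi> (T x)) \<epsilon> \<longleftrightarrow> codable \<phi> \<epsilon>"
proof -
  have im: "itins (\<lambda>x. \<phi> (T x)) N = itins \<phi> N" for N
    unfolding itinerary_shift by (metis image_image T_surj)
  have "(\<integral>x. F (itinerary T (\<lambda>x. \<phi> (T x)) N x) \<partial>M) = (\<integral>x. F (itinerary T \<phi> N x) \<partial>M)"
    for F :: "_ \<Rightarrow> real" and N
  proof -
    have "(\<integral>x. F (itinerary T \<phi> N x) \<partial>M) = (\<integral>x. F (itinerary T \<phi> N x) \<partial>distr M M T)"
      by (simp add: T_invariant)
    also have "\<dots> = (\<integral>x. F (itinerary T \<phi> N (T x)) \<partial>M)"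
      by (rule integral_distr[OF T_measurable borel_measurable_integrable])
        (rule integrable_itinerary[where F=F, OF sf])
    finally show ?thesis by (simp add: itinerary_shift)
  qed
  note * = this
  have "(\<integral>x. - ln (Q (itinerary T (\<lambda>x. \<phi> (T x)) N x)) \<partial>M) = (\<integral>x. - ln (Q (itinerary T \<phi> N x)) \<partial>M)"
    for Q :: "_ \<Rightarrow> real" and N
    by (rule *[of "\<lambda>u. - ln (Q u)"])
  then have "codable_at (\<lambda>x. \<phi> (T x)) N r \<longleftrightarrow> codable_at \<phi> N r" for N r
    unfolding codable_at_def im by simp
  moreover have "simple_function M (\<lambda>x. \<phi> (T x))"
    by (rule simple_function_comp[OF T_measurable sf])
  ultimately show ?thesis
    using sf by (simp add: codable_def)
qed

end

section \<open>The algebra of cheap events\<close>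

text \<open>Weights with \<open>sum w A = 1\<close> thus give a probability on the words of length
  \<open>N\<close>: the law of independent letters.\<close>

lemma sum_prod_list_lists:
  fixes w :: "'a \<Rightarrow> 'b :: comm_semiring_1"
  assumes "finite A"
  shows "(\<Sum>u | set u \<subseteq> A \<and> length u = N. prod_list (map w u)) = sum w A ^ N"
proof (induction N)
  case 0
  have "{u. set u \<subseteq> A \<and> length u = 0} = {[]}" by auto
  then show ?case by simp
next
  case (Suc N)
  let ?L = "\<lambda>N. {u. set u \<subseteq> A \<and> length u = N}"
  have "(\<Sum>u\<in>?L (Suc N). prod_list (map w u)) =
      (\<Sum>(u, a)\<in>?L N \<times> A. prod_list (map w u) * w a)"
    unfolding lists_length_Suc_eq
    by (subst sum.reindex) (auto simp: inj_on_def case_prod_unfold mult.commute)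
  also have "\<dots> = (\<Sum>u\<in>?L N. prod_list (map w u)) * sum w A"
    by (simp add: sum_product sum.cartesian_product)
  finally show ?case by (simp add: Suc.IH mult.commute)
qed

lemma sum_list_itinerary:
  "(\<Sum>a\<leftarrow>itinerary T \<phi> N x. g a) = (\<Sum>i<N. g (\<phi> ((T ^^ i) x)))"
  by (simp add: itinerary_def comp_def interv_sum_list_conv_sum_set_nat atLeast0LessThan)

context measure_preserving_surjection
begin

lemma itinerary_cong:
  "(\<And>x. x \<in> space M \<Longrightarrow> \<phi> x = \<psi> x) \<Longrightarrow> x \<in> space M \<Longrightarrow> itinerary T \<phi> N x = itinerary T \<psi> N x"
  by (simp add: itinerary_def T_pow_space)

lemma codable_cong:
  assumes eq: "\<And>x. x \<in> space M \<Longrightarrow> \<phi> x = \<psi> x"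
  shows "codable \<phi> \<epsilon> \<longleftrightarrow> codable \<psi> \<epsilon>"
proof -
  have i: "itinerary T \<phi> N x = itinerary T \<psi> N x" if "x \<in> space M" for N x
    using eq that by (rule itinerary_cong)
  then have im: "itins \<phi> N = itins \<psi> N" for N
    by (rule image_cong[OF refl])
  have "(\<integral>x. - ln (Q (itinerary T \<phi> N x)) \<partial>M) = (\<integral>x. - ln (Q (itinerary T \<psi> N x)) \<partial>M)"
    for Q :: "_ \<Rightarrow> real" and N
    by (rule Bochner_Integration.integral_cong) (simp_all add: i)
  then have "codable_at \<phi> N r \<longleftrightarrow> codable_at \<psi> N r" for N r
    unfolding codable_at_def im by simp
  then show ?thesis
    using simple_function_cong[of M \<phi> \<psi>, OF eq] by (simp add: codable_def)
qed

lemma simple_function_member: "A \<in> events \<Longrightarrow> simple_function M (\<lambda>x. x \<in> A)"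
  using simple_function_compose1[OF simple_function_indicator[of A M, where ?'b=nat], of "\<lambda>i. i = 1"]
  by (simp add: indicator_def of_bool_def split: if_splits)

lemma prob_T_pow_vimage:
  assumes "A \<in> events"
  shows "prob {x \<in> space M. (T ^^ i) x \<in> A} = prob A"
proof -
  have "prob A = measure (distr M M (T ^^ i)) A"
    by (simp add: distr_T_pow)
  also have "\<dots> = prob ((T ^^ i) -` A \<inter> space M)"
    using assms by (rule measure_distr[OF T_pow_measurable])
  finally show ?thesis by (simp add: vimage_def Int_def conj_commute)
qed

text \<open>The code of independent letters, with probability \<open>t\<close> for
  \<open>True\<close>. By invariance each letter has the same expected cost, the left side of the
  hypothesis on \<open>r\<close>; so the bound holds for every \<open>N\<close>.\<close>

lemma codable_event:
  assumes A: "A \<in> events" and t: "0 < t" "t < 1"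
    and r: "- prob A * ln t - (1 - prob A) * ln (1 - t) \<le> r"
  shows "codable (\<lambda>x. x \<in> A) r"
proof -
  let ?\<phi> = "\<lambda>x. x \<in> A"
  note sf = simple_function_member[OF A]
  define w where "w b = (if b then t else 1 - t)" for b
  have w: "0 < w b" for b using t by (simp add: w_def)
  have pos: "0 < prod_list (map w u)" for u
    by (induction u) (simp_all add: w)
  have ln: "- ln (prod_list (map w u)) = (\<Sum>b\<leftarrow>u. - ln (w b))" for u
    by (induction u) (simp_all add: ln_mult_pos pos w)
  have "codable_at ?\<phi> N (r * N)" for N
  proof (rule codable_atI[where Q="\<lambda>u. prod_list (map w u)"])
    have "(\<Sum>u\<in>itins ?\<phi> N. prod_list (map w u)) \<le>
        (\<Sum>u | set u \<subseteq> UNIV \<and> length u = N. prod_list (map w u))"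
      by (rule sum_mono2[OF finite_lists_length_eq]) (auto intro: less_imp_le pos)
    also have "\<dots> = 1"
      by (subst sum_prod_list_lists) (simp_all add: UNIV_bool w_def)
    finally show "(\<Sum>u\<in>itins ?\<phi> N. prod_list (map w u)) \<le> 1" .
    have meas: "{x \<in> space M. (T ^^ i) x \<in> A} \<in> events" for i
      using measurable_sets[OF T_pow_measurable A] by (simp add: vimage_def Int_def conj_commute)
    have int: "integrable M (indicator {x \<in> space M. (T ^^ i) x \<in> A} :: 'a \<Rightarrow> real)" for i
      by (intro integrable_real_indicator meas) (simp add: less_top[symmetric])
    \<comment> \<open>The cost of a letter is affine in the indicator of the event, so its integral
      involves only \<open>prob A\<close>.\<close>
    have "(\<integral>x. - ln (prod_list (map w (itinerary T ?\<phi> N x))) \<partial>M) =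
        (\<integral>x. (\<Sum>i<N. - ln (1 - t) + (ln (1 - t) - ln t) *
          indicator {x \<in> space M. (T ^^ i) x \<in> A} x) \<partial>M)"
      by (intro Bochner_Integration.integral_cong refl, unfold ln sum_list_itinerary)
        (auto simp: w_def indicator_def intro!: sum.cong)
    also have "\<dots> = (\<Sum>i<N. - ln (1 - t) + (ln (1 - t) - ln t) * prob A)"
    proof -
      have "(\<integral>x. - ln (1 - t) + (ln (1 - t) - ln t) * indicator {x \<in> space M. (T ^^ i) x \<in> A} x \<partial>M) =
         - ln (1 - t) + (ln (1 - t) - ln t) * prob A" for i
        using int[of i] meas[of i]
        by (simp add: Bochner_Integration.integral_add prob_T_pow_vimage[OF A] prob_space Int_absorb2 subset_eq)
      moreover have "integrable M (\<lambda>x. - ln (1 - t) + (ln (1 - t) - ln t) * indicator {x \<in> space M. (T ^^ i) x \<in> A} x)" for i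
        using int[of i] by simp
      ultimately show ?thesis by (simp add: Bochner_Integration.integral_sum)
    qed
    also have "\<dots> \<le> r * N"
      using mult_left_mono[OF r, of "real N"] by (simp add: algebra_simps)
    finally show "(\<integral>x. - ln (prod_list (map w (itinerary T ?\<phi> N x))) \<partial>M) \<le> r * N" .
  qed (rule pos)
  then show ?thesis
    using sf by (simp add: codable_def)
qed

definition cheap :: "('a \<Rightarrow> 'b) \<Rightarrow> bool" where
  "cheap \<phi> \<longleftrightarrow> (\<forall>\<epsilon>>0. codable \<phi> \<epsilon>)"

definition cheap_events :: "'a set set" where
  "cheap_events = {A \<in> events. cheap (\<lambda>x. x \<in> A)}"

lemma cheap_comp: "cheap \<phi> \<Longrightarrow> cheap (\<lambda>x. g (\<phi> x))"
  by (simp add: cheap_def codable_comp)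

lemma cheap_cong: "(\<And>x. x \<in> space M \<Longrightarrow> \<phi> x = \<psi> x) \<Longrightarrow> cheap \<phi> \<longleftrightarrow> cheap \<psi>"
  unfolding cheap_def using codable_cong by blast

lemma cheap_Pair:
  assumes "cheap \<phi>" "cheap \<psi>"
  shows "cheap (\<lambda>x. (\<phi> x, \<psi> x))"
  unfolding cheap_def
proof (intro allI impI)
  fix \<epsilon> :: real assume "0 < \<epsilon>"
  then show "codable (\<lambda>x. (\<phi> x, \<psi> x)) \<epsilon>"
    using codable_Pair[of \<phi> "\<epsilon> / 2" \<psi> "\<epsilon> / 2"] assms by (simp add: cheap_def)
qed

lemma cheap_comp2: "cheap \<phi> \<Longrightarrow> cheap \<psi> \<Longrightarrow> cheap (\<lambda>x. h (\<phi> x) (\<psi> x))"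
  using cheap_comp[OF cheap_Pair, of \<phi> \<psi> "\<lambda>(a, b). h a b"] by simp

lemma cheap_shift: "simple_function M \<phi> \<Longrightarrow> cheap (\<lambda>x. \<phi> (T x)) \<longleftrightarrow> cheap \<phi>"
  by (simp add: cheap_def codable_shift)

lemma cheap_imp_simple_function: "cheap \<phi> \<Longrightarrow> simple_function M \<phi>"
  using zero_less_one[where ?'a=real] unfolding cheap_def codable_def by blast

lemma cheap_Collect:
  assumes "cheap \<phi>"
  shows "{x \<in> space M. P (\<phi> x)} \<in> cheap_events"
proof -
  have "{x \<in> space M. P (\<phi> x)} = \<phi> -` Collect P \<inter> space M" by auto
  then have "{x \<in> space M. P (\<phi> x)} \<in> events"
    by (simp only: simple_functionD(2)[OF cheap_imp_simple_function[OF assms]])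
  moreover have "cheap (\<lambda>x. x \<in> {x \<in> space M. P (\<phi> x)})"
    using cheap_comp[OF assms, of P] cheap_cong[of "\<lambda>x. P (\<phi> x)" "\<lambda>x. x \<in> {x \<in> space M. P (\<phi> x)}"]
    by simp
  ultimately show ?thesis by (simp add: cheap_events_def)
qed

text \<open>
  The difference to a close cheap event is coded by independent biased coins.
\<close>

lemma cheap_eventsI:
  assumes A: "A \<in> events"
    and approx: "\<And>\<delta>. 0 < \<delta> \<Longrightarrow> \<exists>B\<in>cheap_events. prob ((A - B) \<union> (B - A)) < \<delta>"
  shows "A \<in> cheap_events"
proof -
  have "codable (\<lambda>x. x \<in> A) \<epsilon>" if \<epsilon>: "0 < \<epsilon>" for \<epsilon>
  proof -
    \<comment> \<open>Then \<open>- ln (1 - t) = \<epsilon> / 4\<close>, so a letter at which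
      nothing differs costs \<open>\<epsilon> / 4\<close>. The other letter may be expensive, but
      \<open>B\<close> is taken so close that its expected cost \<open>- prob D * ln t\<close> is
      below \<open>\<epsilon> / 4\<close> as well; the remaining \<open>\<epsilon> / 2\<close> is
      for \<open>B\<close>.\<close>
    define t where "t = 1 - exp (- \<epsilon> / 4)"
    have t: "0 < t" "t < 1" "ln (1 - t) = - \<epsilon> / 4" and lt: "ln t < 0"
      using \<epsilon> by (auto simp: t_def)
    obtain B where B: "B \<in> cheap_events" "prob ((A - B) \<union> (B - A)) < \<epsilon> / (4 * - ln t)"
      using approx[of "\<epsilon> / (4 * - ln t)"] divide_pos_pos[OF \<epsilon>, of "4 * - ln t"] lt by auto
    define D where "D = (A - B) \<union> (B - A)"
    have BD: "B \<in> events" "D \<in> events"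
      using A B by (auto simp: cheap_events_def D_def)
    have "prob D * (4 * - ln t) < \<epsilon>"
      using B(2) lt unfolding D_def by (subst (asm) pos_less_divide_eq) auto
    moreover have "(1 - prob D) * (\<epsilon> / 4) \<le> \<epsilon> / 4"
      using \<epsilon> by (simp add: mult_le_cancel_right1)
    ultimately have "- prob D * ln t - (1 - prob D) * ln (1 - t) \<le> \<epsilon> / 2"
      unfolding t(3) by (simp add: algebra_simps)
    then have "codable (\<lambda>x. x \<in> D) (\<epsilon> / 2)"
      using codable_event BD t by blast
    moreover have "codable (\<lambda>x. x \<in> B) (\<epsilon> / 2)"
      using B(1) \<epsilon> by (simp add: cheap_events_def cheap_def)
    ultimately have "codable (\<lambda>x. (x \<in> B, x \<in> D)) (\<epsilon> / 2 + \<epsilon> / 2)"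
      by (intro codable_Pair)
    then have "codable (\<lambda>x. case (x \<in> B, x \<in> D) of (b, d) \<Rightarrow> b \<noteq> d) (\<epsilon> / 2 + \<epsilon> / 2)"
      by (rule codable_comp)
    moreover have "(\<lambda>x. case (x \<in> B, x \<in> D) of (b, d) \<Rightarrow> b \<noteq> d) = (\<lambda>x. x \<in> A)"
      by (auto simp: D_def)
    ultimately show ?thesis by simp
  qed
  then show ?thesis
    using A by (simp add: cheap_events_def cheap_def)
qed

text \<open>Complements and finite unions relabel single bits or pairs of bits. Countable unions are
  approximated by the finite partial unions, by continuity of the measure from below.\<close>

lemma sigma_algebra_cheap_events: "sigma_algebra (space M) cheap_events"
  unfolding sigma_algebra_iff2
proof (intro conjI ballI allI impI)
  show "cheap_events \<subseteq> Pow (space M)"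
    using sets.sets_into_space by (auto simp: cheap_events_def)
  show empty: "{} \<in> cheap_events"
  proof -
    \<comment> \<open>For an event of probability 0 only the letter \<open>False\<close> is paid
      for, and this \<open>t\<close> makes its cost exactly \<open>\<epsilon>\<close>.\<close>
    have "codable (\<lambda>x. x \<in> {}) \<epsilon>" if "0 < \<epsilon>" for \<epsilon>
      using that by (intro codable_event[of _ "1 - exp (- \<epsilon>)"]) auto
    then show ?thesis by (simp add: cheap_events_def cheap_def)
  qed
  show compl: "space M - A \<in> cheap_events" if "A \<in> cheap_events" for A
  proof -
    have "cheap (\<lambda>x. x \<notin> A)"
      using that by (auto simp: cheap_events_def intro: cheap_comp[where g=Not])
    then have "cheap (\<lambda>x. x \<in> space M - A)"
      using cheap_cong[of "\<lambda>x. x \<notin> A" "\<lambda>x. x \<in> space M - A"] by simp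
    then show ?thesis
      using that by (simp add: cheap_events_def sets.compl_sets)
  qed
  have union: "A \<union> B \<in> cheap_events" if "A \<in> cheap_events" "B \<in> cheap_events" for A B
    using that by (auto simp: cheap_events_def intro: cheap_comp2[where h="(\<or>)"])
  show "(\<Union>i::nat. A i) \<in> cheap_events" if "range A \<subseteq> cheap_events" for A
  proof (rule cheap_eventsI)
    define B where "B n = (\<Union>i<n. A i)" for n
    have B: "B n \<in> cheap_events" for n
    proof (induction n)
      case (Suc n)
      have "B (Suc n) = B n \<union> A n"
        by (auto simp: B_def lessThan_Suc)
      moreover have "A n \<in> cheap_events"
        using that by blast
      ultimately show ?case
        using union[OF Suc.IH] by simp
    qed (simp add: B_def empty)
    have ev: "B n \<in> events" for n
      using B by (auto simp: cheap_events_def)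
    have UN: "(\<Union>i. B i) = (\<Union>i. A i)"
      by (auto simp: B_def)
    show "(\<Union>i. A i) \<in> events"
      using that by (auto simp: cheap_events_def)
    have "incseq B"
      unfolding B_def incseq_def by (intro allI impI UN_mono) auto
    then have "(\<lambda>n. prob (B n)) \<longlonglongrightarrow> prob (\<Union>i. B i)"
      using ev by (intro finite_Lim_measure_incseq) auto
    then have lim: "(\<lambda>n. prob (B n)) \<longlonglongrightarrow> prob (\<Union>i. A i)"
      by (simp only: UN)
    fix \<delta> :: real assume "0 < \<delta>"
    then obtain n where "dist (prob (B n)) (prob (\<Union>i. A i)) < \<delta>"
      using lim unfolding lim_sequentially by blast
    moreover have "prob ((\<Union>i. A i) - B n) = prob (\<Union>i. A i) - prob (B n)"
      using ev that by (intro finite_measure_Diff) (auto simp: B_def cheap_events_def)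
    moreover have "((\<Union>i. A i) - B n) \<union> (B n - (\<Union>i. A i)) = (\<Union>i. A i) - B n"
      by (auto simp: B_def)
    ultimately show "\<exists>B\<in>cheap_events. prob (((\<Union>i. A i) - B) \<union> (B - (\<Union>i. A i))) < \<delta>"
      using B[of n] by (intro bexI[of _ "B n"]) (auto simp: dist_real_def)
  qed
qed

section \<open>From cheap partitions to zero entropy\<close>

lemma cheap_partition:
  assumes "finite P" "P \<subseteq> cheap_events"
  shows "cheap (\<lambda>x. {A \<in> P. x \<in> A})"
  using assms
proof (induction P)
  case empty
  have "{} \<in> cheap_events"
    by (rule sigma_algebra.axioms(1)[OF sigma_algebra_cheap_events, THEN algebra.axioms(1),
          THEN ring_of_sets.axioms(1), THEN semiring_of_sets.empty_sets])
  then have "cheap (\<lambda>x. x \<in> ({} :: 'a set))"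
    by (simp add: cheap_events_def)
  from cheap_comp[OF this, of "\<lambda>_. {}"] show ?case by simp
next
  \<comment> \<open>The label of \<open>x\<close> is the set of all members of \<open>P\<close>
    containing it, so one new member adds one bit.\<close>
  case (insert A P)
  have "cheap (\<lambda>x. x \<in> A)"
    using insert.prems by (simp add: cheap_events_def)
  from cheap_comp2[OF this insert.IH, of "\<lambda>b S. if b then insert A S else S"] insert.prems
  have "cheap (\<lambda>x. if x \<in> A then insert A {A \<in> P. x \<in> A} else {A \<in> P. x \<in> A})"
    by simp
  also have "(\<lambda>x. if x \<in> A then insert A {A \<in> P. x \<in> A} else {A \<in> P. x \<in> A}) =
      (\<lambda>x. {B \<in> insert A P. x \<in> B})"
    by (rule ext) auto
  finally show ?case .
qed

text \<open>A nonempty cell contains a point \<open>y\<close>, whose itinerary determines the whole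
  cell; discarding \<open>{}\<close> on the left corresponds to using only realised itineraries on
  the right.\<close>

lemma dynamical_join_eq:
  assumes P: "partition_on (space M) P"
  defines "\<phi> \<equiv> \<lambda>x. {A \<in> P. x \<in> A}"
  shows "dynamical_join M T P N = (\<lambda>u. {x \<in> space M. itinerary T \<phi> N x = u}) ` itins \<phi> N"
    (is "_ = ?F ` _")
proof -
  \<comment> \<open>For a partition the label of a point in a cell \<open>B\<close> is
    \<open>{B}\<close>, so equal labels mean the same cell.\<close>
  have eq: "\<phi> y = \<phi> z \<longleftrightarrow> y \<in> B" if "y \<in> space M" "z \<in> B" "B \<in> P" for y z B
  proof -
    have "\<phi> y' = {B'}" if "y' \<in> B'" "B' \<in> P" for y' B'
      using P that by (auto simp: \<phi>_def partition_on_def disjoint_def)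
    then show ?thesis
      using P that unfolding partition_on_def by (metis UnionE singleton_inject)
  qed
  have same: "{x \<in> space M. \<forall>i<N. (T ^^ i) x \<in> A i} = ?F (itinerary T \<phi> N y)"
    if "\<forall>i<N. A i \<in> P \<and> (T ^^ i) y \<in> A i" for A y
  proof -
    have "(\<forall>i<N. (T ^^ i) x \<in> A i) \<longleftrightarrow> itinerary T \<phi> N x = itinerary T \<phi> N y" if "x \<in> space M" for x
      using \<open>\<forall>i<N. A i \<in> P \<and> (T ^^ i) y \<in> A i\<close> that eq[OF T_pow_space]
      by (simp add: itinerary_def map_eq_conv) (metis atLeast0LessThan lessThan_iff)
    then show ?thesis by blast
  qed
  show ?thesis
  proof (intro equalityI subsetI)
    fix X assume "X \<in> dynamical_join M T P N"
    then obtain A y where A: "X = {x \<in> space M. \<forall>i<N. (T ^^ i) x \<in> A i}" "\<forall>i<N. A i \<in> P" "y \<in> X"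
      unfolding dynamical_join_def by blast
    then show "X \<in> ?F ` itins \<phi> N"
      using same[of A y] by auto
  next
    fix X assume "X \<in> ?F ` itins \<phi> N"
    then obtain y where y: "y \<in> space M" "X = ?F (itinerary T \<phi> N y)" by auto
    have "\<exists>B. B \<in> P \<and> (T ^^ i) y \<in> B" for i
      using T_pow_space[OF y(1), of i] P by (auto simp: partition_on_def)
    then obtain A where A: "\<And>i. A i \<in> P \<and> (T ^^ i) y \<in> A i" by metis
    then have "X = {x \<in> space M. \<forall>i<N. (T ^^ i) x \<in> A i}"
      using same[of A y] y by simp
    moreover have "y \<in> X" using y by simp
    ultimately show "X \<in> dynamical_join M T P N"
      using A unfolding dynamical_join_def by auto
  qed
qed

lemma partition_entropy_le:
  assumes P: "finite_measurable_partition M P"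
    and c: "codable_at (\<lambda>x. {A \<in> P. x \<in> A}) N r" and sf: "simple_function M (\<lambda>x. {A \<in> P. x \<in> A})"
  shows "partition_entropy M (dynamical_join M T P N) \<le> r"
proof -
  define \<phi> where "\<phi> x = {A \<in> P. x \<in> A}" for x
  note sf = sf[folded \<phi>_def]
  define p where "p u = prob {x \<in> space M. itinerary T \<phi> N x = u}" for u
  obtain Q where Q: "\<And>u. u \<in> itins \<phi> N \<Longrightarrow> 0 < Q u" "sum Q (itins \<phi> N) \<le> 1"
    "(\<integral>x. - ln (Q (itinerary T \<phi> N x)) \<partial>M) \<le> r"
    using c unfolding codable_at_def \<phi>_def by blast
  have join: "dynamical_join M T P N = (\<lambda>u. {x \<in> space M. itinerary T \<phi> N x = u}) ` itins \<phi> N"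
    using P dynamical_join_eq[of P N] unfolding finite_measurable_partition_def \<phi>_def by simp
  \<comment> \<open>Fibres over distinct realised itineraries are nonempty and disjoint, so the
    cells are indexed without repetition.\<close>
  have "partition_entropy M (dynamical_join M T P N) = - (\<Sum>u\<in>itins \<phi> N. p u * ln (p u))"
    unfolding partition_entropy_def join p_def
    by (subst sum.reindex) (auto simp: inj_on_def)
  also have "\<dots> \<le> (\<Sum>u\<in>itins \<phi> N. p u * - ln (Q u))"
  proof (rule gibbs_inequality)
    show "sum p (itins \<phi> N) = 1"
      using integral_itinerary[OF sf, of "\<lambda>_. 1" N] by (simp add: p_def prob_space)
  qed (use Q in \<open>auto simp: p_def\<close>)
  also have "\<dots> = (\<integral>x. - ln (Q (itinerary T \<phi> N x)) \<partial>M)"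
    unfolding p_def by (rule integral_itinerary[OF sf, symmetric])
  finally show ?thesis using Q(3) by simp
qed

lemma partition_entropy_nonneg: "0 \<le> partition_entropy M P"
proof -
  have "prob A * ln (prob A) \<le> 0" for A
    using measure_nonneg[of M A] prob_le_1[of A]
    by (cases "prob A = 0") (simp_all add: mult_nonneg_nonpos ln_le_zero_iff less_le)
  then show ?thesis
    unfolding partition_entropy_def by (simp add: sum_nonpos)
qed

theorem ks_entropy_eq_0:
  assumes "events \<subseteq> cheap_events"
  shows "ks_entropy M T = 0"
proof -
  have zero: "entropy_wrt_partition M T P = 0" if P: "finite_measurable_partition M P" for P
  proof -
    let ?H = "\<lambda>N. partition_entropy M (dynamical_join M T P N) / N"
    have cheap: "cheap (\<lambda>x. {A \<in> P. x \<in> A})"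
      using P assms by (intro cheap_partition) (auto simp: finite_measurable_partition_def)
    \<comment> \<open>As \<open>lim\<close> is informative only for convergent sequences,
      convergence itself is proved: the entropies are nonnegative and eventually at most
      \<open>\<epsilon> / 2 * N\<close>.\<close>
    have "?H \<longlonglongrightarrow> 0"
    proof (rule tendstoI)
      fix \<epsilon> :: real assume "0 < \<epsilon>"
      then have c: "codable (\<lambda>x. {A \<in> P. x \<in> A}) (\<epsilon> / 2)"
        using cheap by (simp add: cheap_def)
      then have "\<forall>\<^sub>F N in sequentially. codable_at (\<lambda>x. {A \<in> P. x \<in> A}) N (\<epsilon> / 2 * N)"
        by (simp add: codable_def)
      then show "\<forall>\<^sub>F N in sequentially. dist (?H N) 0 < \<epsilon>"
        using eventually_gt_at_top[of 0]
      proof eventually_elim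
        case (elim N)
        have "partition_entropy M (dynamical_join M T P N) \<le> \<epsilon> / 2 * N"
          using c elim(1) by (intro partition_entropy_le P) (auto simp: codable_def)
        then have "?H N \<le> \<epsilon> / 2"
          using elim(2) by (simp add: divide_le_eq)
        moreover have "0 \<le> ?H N"
          by (simp add: partition_entropy_nonneg)
        ultimately show ?case
          using \<open>0 < \<epsilon>\<close> unfolding dist_real_def by linarith
      qed
    qed
    then show ?thesis
      unfolding entropy_wrt_partition_def by (rule limI)
  qed
  \<comment> \<open>The trivial partition shows that the supremum is over a nonempty set; over the
    empty set it would be \<open>-\<infinity>\<close> in \<open>ereal\<close>.\<close>
  have "partition_on (space M) {space M}"
    using not_empty by (simp add: partition_on_def)
  then have "finite_measurable_partition M {space M}"
    by (simp add: finite_measurable_partition_def)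
  then have "{P. finite_measurable_partition M P} \<noteq> {}" by blast
  moreover have "ks_entropy M T = (SUP P\<in>{P. finite_measurable_partition M P}. 0)"
    unfolding ks_entropy_def by (rule SUP_cong) (simp_all add: zero zero_ereal_def)
  ultimately show ?thesis by simp
qed

end

section \<open>Coding words by blocks\<close>

text \<open>
  A mixture code: a letter is spelled out with probability \<open>1 / (2 k)\<close>, and a whole copy of \<open>w\<close> is
  emitted with probability \<open>1 / 2\<close>; \<open>k\<close> is the size of the alphabet.
\<close>

fun block_code :: "nat \<Rightarrow> 'a list \<Rightarrow> 'a list \<Rightarrow> real" where
  "block_code k w [] = 1"
| "block_code k w (a # u) = block_code k w u / (2 * k) +
     (if take (length w) (a # u) = w then block_code k w (drop (length w - 1) u) / 2 else 0)"

lemma block_code_pos: "0 < k \<Longrightarrow> 0 < block_code k w u"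
  by (induction k w u rule: block_code.induct) (simp_all add: add_pos_pos del: take_Suc_Cons)

text \<open>Strong induction on \<open>N\<close>. Splitting off a first letter contributes half the
  mass at length \<open>N - 1\<close>; splitting off a copy of \<open>w\<close> contributes at most
  half the mass at length \<open>N - length w\<close>, because the rest determines the word.\<close>

lemma sum_block_code:
  assumes A: "finite A" "0 < card A" and w: "w \<noteq> []"
  shows "sum (block_code (card A) w) {u. set u \<subseteq> A \<and> length u = N} \<le> 1"
proof (induction N rule: less_induct)
  case (less N)
  let ?k = "card A"
  let ?Q = "block_code ?k w"
  let ?L = "\<lambda>N. {u. set u \<subseteq> A \<and> length u = N}"
  note fin = finite_lists_length_eq[OF A(1)]
  show ?case
  proof (cases N)
    case 0
    then have "?L N = {[]}" by auto
    then show ?thesis by simp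
  next
    case (Suc n)
    let ?R = "\<lambda>u. if take (length w) u = w then ?Q (drop (length w) u) / 2 else 0"
    \<comment> \<open>As \<open>w\<close> is nonempty, dropping \<open>length w - 1\<close> letters
      from \<open>u\<close> is dropping \<open>length w\<close> letters from \<open>a # u\<close>;
      so \<open>?R\<close> depends on the whole word only.\<close>
    have Q: "?Q (a # u) = ?Q u / (2 * ?k) + ?R (a # u)" for a u
      using w by (cases w) auto
    have "sum ?Q (?L N) = (\<Sum>(u, a)\<in>?L n \<times> A. ?Q u / (2 * ?k)) + sum ?R (?L N)"
      unfolding Suc lists_length_Suc_eq
      by (simp add: sum.reindex inj_on_def case_prod_unfold Q sum.distrib
          del: block_code.simps take_Suc_Cons)
    also have "(\<Sum>(u, a)\<in>?L n \<times> A. ?Q u / (2 * ?k)) = sum ?Q (?L n) / 2"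
    proof -
      have "A \<noteq> {}" using A by auto
      then show ?thesis
        using A by (simp add: sum.cartesian_product[symmetric] sum_divide_distrib)
    qed
    also have "\<dots> \<le> 1 / 2"
      using less.IH[of n] Suc by simp
    also have "sum ?R (?L N) \<le> 1 / 2"
    proof (cases "length w \<le> N")
      case True
      let ?U = "{u \<in> ?L N. take (length w) u = w}"
      have "sum ?R (?L N) = (\<Sum>u\<in>?U. ?Q (drop (length w) u) / 2)"
        by (rule sum.inter_filter[OF fin, symmetric])
      also have "\<dots> = sum ?Q (drop (length w) ` ?U) / 2"
      proof -
        have "inj_on (drop (length w)) ?U"
          by (rule inj_onI) (metis (mono_tags, lifting) append_take_drop_id mem_Collect_eq)
        then show ?thesis
          by (simp add: sum.reindex sum_divide_distrib)
      qed
      also have "\<dots> \<le> sum ?Q (?L (N - length w)) / 2"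
        using A fin set_drop_subset
        by (intro divide_right_mono sum_mono2) (fastforce intro: less_imp_le block_code_pos)+
      also have "\<dots> \<le> 1 / 2"
        using less.IH[of "N - length w"] w Suc by simp
      finally show ?thesis .
    next
      case False
      have "?R u = 0" if "u \<in> ?L N" for u
        using that False by auto
      then have "sum ?R (?L N) = 0"
        by (intro sum.neutral) blast
      then show ?thesis by simp
    qed
    finally show ?thesis by simp
  qed
qed

definition block_cost :: "nat \<Rightarrow> 'a list \<Rightarrow> 'a list \<Rightarrow> real" where
  "block_cost k w u = - ln (block_code k w u)"

lemma block_cost_Nil [simp]: "block_cost k w [] = 0"
  by (simp add: block_cost_def)

lemma block_cost_Cons:
  assumes "0 < k"
  shows "block_cost k w (a # u) \<le> ln (2 * k) + block_cost k w u"
proof -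
  have "block_code k w u / (2 * k) \<le> block_code k w (a # u)"
    using assms by (simp add: block_code_pos less_imp_le)
  moreover have "0 < block_code k w u / (2 * k)"
    using assms by (simp add: block_code_pos)
  ultimately have "ln (block_code k w u / (2 * k)) \<le> ln (block_code k w (a # u))"
    by simp
  moreover have "ln (block_code k w u / (2 * k)) = ln (block_code k w u) - ln (2 * k)"
    using assms block_code_pos[OF assms, of w u] by (intro ln_divide_pos) auto
  ultimately show ?thesis
    by (simp add: block_cost_def)
qed

lemma block_cost_append:
  assumes "0 < k"
  shows "block_cost k w (v @ u) \<le> ln (2 * k) * length v + block_cost k w u"
proof (induction v)
  case (Cons a v)
  then show ?case
    using block_cost_Cons[OF assms, of w a "v @ u"] by (simp add: distrib_left)
qed simp

lemma block_cost_block: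
  assumes "0 < k" "w \<noteq> []"
  shows "block_cost k w (w @ u) \<le> ln 2 + block_cost k w u"
proof -
  obtain a v where w: "w = a # v" using assms(2) by (cases w) auto
  have "block_code k w u / 2 \<le> block_code k w (w @ u)"
    using assms by (simp add: w block_code_pos less_imp_le)
  moreover have "0 < block_code k w u / 2"
    using assms by (simp add: block_code_pos)
  ultimately have "ln (block_code k w u / 2) \<le> ln (block_code k w (w @ u))"
    by simp
  moreover have "ln (block_code k w u / 2) = ln (block_code k w u) - ln 2"
    using block_code_pos[OF assms(1), of w u] by (intro ln_divide_pos) auto
  ultimately show ?thesis
    by (simp add: block_cost_def)
qed

section \<open>Parsing words into copies and spacers\<close>

text \<open>
  \<open>None\<close> stands for a copy of \<open>w\<close> and \<open>Some a\<close> for a single spacer letter; the Boolean marks spacers.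
\<close>

definition spell :: "'a list \<Rightarrow> 'a option list \<Rightarrow> ('a \<times> bool) list" where
  "spell w ts = concat (map (\<lambda>t. case t of None \<Rightarrow> map (\<lambda>a. (a, False)) w | Some a \<Rightarrow> [(a, True)]) ts)"

abbreviation num_spacers :: "('a \<times> bool) list \<Rightarrow> nat" where
  "num_spacers u \<equiv> length (filter snd u)"

lemma spell_simps [simp]:
  "spell w [] = []"
  "spell w (None # ts) = map (\<lambda>a. (a, False)) w @ spell w ts"
  "spell w (Some a # ts) = (a, True) # spell w ts"
  "spell w (ts @ ts') = spell w ts @ spell w ts'"
  by (simp_all add: spell_def)

lemma spell_concat_replicate: "spell w (concat (replicate n ts)) = concat (replicate n (spell w ts))"
  by (induction n) simp_all

lemma spell_map_Some: "spell w (map Some u) = map (\<lambda>a. (a, True)) u"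
  by (induction u) simp_all

lemma num_spacers_unmarked: "num_spacers (map (\<lambda>a. (a, False)) u) = 0"
  by (induction u) simp_all

context
  fixes k :: nat and w :: "'a list"
  assumes k: "0 < k" and w: "w \<noteq> []"
begin

text \<open>Each of the at most \<open>N / length w\<close> complete copies costs
  \<open>ln 2\<close> and each spacer \<open>ln (2 * k)\<close>. Only the last copy can be cut off
  by the window; it is spelled out letter by letter, at a cost of at most
  \<open>ln (2 * k) * length w\<close>.\<close>

lemma block_cost_take_spell:
  "block_cost k w (map fst (take N (spell w ts))) \<le>
     ln (2 * k) * (num_spacers (take N (spell w ts)) + length w) + N / length w * ln 2"
proof (induction ts arbitrary: N)
  case Nil
  then show ?case using k by simp
next
  case (Cons t ts)
  have lk: "0 \<le> ln (2 * real k)" using k by simp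
  show ?case
  proof (cases t)
    case None
    show ?thesis
    proof (cases "length w \<le> N")
      case True
      define n where "n = N - length w"
      have N: "N = length w + n" using True by (simp add: n_def)
      have "block_cost k w (map fst (take N (spell w (t # ts)))) =
          block_cost k w (w @ map fst (take n (spell w ts)))"
        by (simp add: None N comp_def)
      also have "\<dots> \<le> ln 2 + block_cost k w (map fst (take n (spell w ts)))"
        by (rule block_cost_block[OF k w])
      also have "\<dots> \<le> ln 2 + (ln (2 * k) * (num_spacers (take n (spell w ts)) + length w) + n / length w * ln 2)"
        using Cons.IH by simp
      also have "\<dots> = ln (2 * k) * (num_spacers (take N (spell w (t # ts))) + length w) + N / length w * ln 2"
        using w by (simp add: None N num_spacers_unmarked add_divide_distrib distrib_right)
      finally show ?thesis .
    next
      case False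
      have "block_cost k w (map fst (take N (spell w (t # ts)))) \<le> ln (2 * k) * N"
        using False block_cost_append[OF k, of w "map fst (take N (spell w (t # ts)))" "[]"]
        by (simp add: None comp_def)
      also have "\<dots> \<le> ln (2 * k) * (num_spacers (take N (spell w (t # ts))) + length w)"
        using False lk by (intro mult_left_mono) auto
      finally show ?thesis
        by (simp add: add_increasing2)
    qed
  next
    case (Some a)
    show ?thesis
    proof (cases N)
      case 0
      then show ?thesis using lk by simp
    next
      case (Suc n)
      have "block_cost k w (map fst (take N (spell w (t # ts)))) \<le>
          ln (2 * k) + block_cost k w (map fst (take n (spell w ts)))"
        using block_cost_Cons[OF k] by (simp add: Some Suc)
      also have "\<dots> \<le> ln (2 * k) + (ln (2 * k) * (num_spacers (take n (spell w ts)) + length w) + n / length w * ln 2)"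
        using Cons.IH by simp
      also have "n / length w * ln 2 \<le> N / length w * ln 2"
        using Suc by (intro mult_right_mono divide_right_mono) auto
      finally show ?thesis
        by (simp add: Some Suc algebra_simps)
    qed
  qed
qed

text \<open>A window that starts at \<open>l\<close> may also cut a copy at its left end; spelling
  out that rest accounts for the second \<open>length w\<close>.\<close>

lemma block_cost_window_spell:
  "block_cost k w (map fst (take N (drop l (spell w ts)))) \<le>
     ln (2 * k) * (num_spacers (take N (drop l (spell w ts))) + 2 * length w) + N / length w * ln 2"
proof (induction ts arbitrary: l)
  case Nil
  then show ?case using k by simp
next
  case (Cons t ts)
  have lk: "0 \<le> ln (2 * real k)" using k by simp
  have 0: ?case if "l = 0"
  proof -
    have "ln (2 * k) * (num_spacers (take N (spell w (t # ts))) + length w) \<le>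
        ln (2 * k) * (num_spacers (take N (spell w (t # ts))) + 2 * length w)"
      using lk by (intro mult_left_mono) auto
    then show ?thesis
      using block_cost_take_spell[of N "t # ts"] by (simp only: that drop_0)
  qed
  show ?case
  proof (cases t)
    case None
    show ?thesis
    proof (cases "length w \<le> l")
      case True
      then show ?thesis using Cons.IH[of "l - length w"] by (simp add: None)
    next
      case False
      define v where "v = map (\<lambda>a. (a, False)) (drop l w)"
      define n where "n = N - length v"
      have v: "num_spacers (take N v) = 0" "length (take N v) \<le> length w"
        using num_spacers_unmarked[of "take N (drop l w)"] by (auto simp: v_def take_map)
      have win: "take N (drop l (spell w (t # ts))) = take N v @ take n (spell w ts)"
        using False by (simp add: None v_def n_def drop_map)
      have "block_cost k w (map fst (take N (drop l (spell w (t # ts))))) \<le>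
          ln (2 * k) * length (take N v) + block_cost k w (map fst (take n (spell w ts)))"
        using block_cost_append[OF k, of w "map fst (take N v)"] by (simp add: win)
      also have "\<dots> \<le> ln (2 * k) * length w +
          (ln (2 * k) * (num_spacers (take n (spell w ts)) + length w) + n / length w * ln 2)"
        using v(2) lk by (intro add_mono block_cost_take_spell mult_left_mono) auto
      also have "n / length w * ln 2 \<le> N / length w * ln 2"
        by (intro mult_right_mono divide_right_mono) (auto simp: n_def)
      finally show ?thesis
        by (simp add: win v algebra_simps)
    qed
  next
    case (Some a)
    then show ?thesis
      using 0 Cons.IH[of "l - 1"] by (cases l) auto
  qed
qed

end

section \<open>Averages over periodic words\<close>

lemma nth_concat_replicate:
  "i < n * length a \<Longrightarrow> concat (replicate n a) ! i = a ! (i mod length a)"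
proof (induction n arbitrary: i)
  case (Suc n)
  then show ?case
    by (cases "i < length a") (auto simp: nth_append mod_if)
qed simp

lemma sum_periodic_shift:
  fixes z :: "nat \<Rightarrow> 'b :: comm_monoid_add"
  assumes "\<And>j. z (j + p) = z j"
  shows "(\<Sum>l<p. z (l + i)) = (\<Sum>l<p. z l)"
proof (induction i)
  case (Suc i)
  have "(\<Sum>l<p. z (l + Suc i)) = (\<Sum>l<p. z (l + i))"
  proof (cases p)
    case (Suc q)
    have "(\<Sum>l<Suc q. z (l + i)) = z i + (\<Sum>l<q. z (l + Suc i))"
      by (subst sum.lessThan_Suc_shift) simp
    then show ?thesis
      using assms[of i] by (simp add: Suc add.commute)
  qed simp
  then show ?case using Suc.IH by simp
qed simp

text \<open>Summed over all starting points in a period, each spacer is counted \<open>N\<close>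
  times, and each window pays for up to two copies cut at its ends.\<close>

lemma sum_block_cost_periodic:
  assumes k: "0 < k" and w: "w \<noteq> []" and s: "s = map fst (spell w ts)"
  shows "(\<Sum>l<length s. block_cost k w (map (\<lambda>i. s ! ((l + i) mod length s)) [0..<N])) \<le>
    ln (2 * k) * (N * num_spacers (spell w ts) + 2 * length w * length s) +
    length s * N / length w * ln 2"
proof -
  define a where "a = spell w ts"
  define p where "p = length s"
  have p: "length a = p" by (simp add: p_def s a_def)
  let ?win = "\<lambda>l. map (\<lambda>i. a ! ((l + i) mod p)) [0..<N]"
  define z :: "nat \<Rightarrow> nat" where "z j = (if snd (a ! (j mod p)) then 1 else 0)" for j
  have count: "num_spacers (map (\<lambda>i. a ! ((l + i) mod p)) [0..<n]) = (\<Sum>i<n. z (l + i))" for l n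
    by (induction n) (simp_all add: z_def)
  have "block_cost k w (map (\<lambda>i. s ! ((l + i) mod p)) [0..<N]) \<le>
      ln (2 * k) * ((\<Sum>i<N. z (l + i)) + 2 * length w) + N / length w * ln 2" if l: "l < p" for l
  proof -
    \<comment> \<open>Since \<open>p \<ge> 1\<close>, \<open>l + N\<close> periods are long enough
      to unroll the cyclic window.\<close>
    have win: "take N (drop l (concat (replicate (l + N) a))) = ?win l"
    proof (rule nth_equalityI)
      have len: "length (concat (replicate n a)) = n * p" for n
        by (induction n) (simp_all add: p)
      have big: "l + N \<le> (l + N) * p" using l by simp
      then show "length (take N (drop l (concat (replicate (l + N) a)))) = length (?win l)"
        unfolding length_take length_drop len length_map length_upt by linarith
      fix i assume "i < length (take N (drop l (concat (replicate (l + N) a))))"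
      then have "i < N" by simp
      moreover from this have "l + i < (l + N) * p" "l \<le> (l + N) * p"
        using big by linarith+
      ultimately show "take N (drop l (concat (replicate (l + N) a))) ! i = ?win l ! i"
        using nth_concat_replicate[of "l + i" "l + N" a] by (simp add: nth_drop len p)
    qed
    have "map fst (?win l) = map (\<lambda>i. s ! ((l + i) mod p)) [0..<N]"
      using l p by (simp add: s a_def[symmetric])
    then show ?thesis
      using block_cost_window_spell[OF k w, of N l "concat (replicate (l + N) ts)"]
      by (simp only: spell_concat_replicate a_def[symmetric] win count)
  qed
  then have "(\<Sum>l<p. block_cost k w (map (\<lambda>i. s ! ((l + i) mod p)) [0..<N])) \<le>
      (\<Sum>l<p. ln (2 * k) * ((\<Sum>i<N. z (l + i)) + 2 * length w) + N / length w * ln 2)"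
    by (intro sum_mono) auto
  also have "\<dots> = ln (2 * k) * (real (\<Sum>l<p. \<Sum>i<N. z (l + i)) + 2 * length w * p) + p * N / length w * ln 2"
    by (simp add: sum.distrib distrib_left sum_distrib_left mult_ac)
  \<comment> \<open>Exchange the sums: for each fixed \<open>i\<close> the shifted period contains
    every spacer exactly once.\<close>
  also have "(\<Sum>l<p. \<Sum>i<N. z (l + i)) = N * num_spacers a"
  proof -
    have "(\<Sum>l<p. \<Sum>i<N. z (l + i)) = (\<Sum>i<N. \<Sum>l<p. z (l + i))"
      by (rule sum.swap)
    also have "\<dots> = (\<Sum>i<N. \<Sum>l<p. z l)"
      by (intro sum.cong refl sum_periodic_shift) (simp add: z_def)
    also have "(\<Sum>l<p. z l) = num_spacers (map (\<lambda>i. a ! ((0 + i) mod p)) [0..<p])"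
      unfolding count by simp
    also have "map (\<lambda>i. a ! ((0 + i) mod p)) [0..<p] = a"
      by (rule nth_equalityI) (simp_all add: p)
    finally show ?thesis by simp
  qed
  finally show ?thesis
    by (simp add: p_def a_def)
qed

lemma length_concat_replicate: "length (concat (replicate n a)) = n * length a"
  by (induction n) simp_all

text \<open>Parse \<open>w (Suc m)\<close> as \<open>\<kappa> m\<close> parsed copies of
  \<open>w m\<close>, with all letters of \<open>\<alpha> m\<close> as spacers. The proportion of
  spacers grows by at most the term at \<open>m\<close>, as \<open>w (Suc m)\<close> has length at
  least \<open>\<kappa> m * length (w m)\<close>.\<close>

lemma ex_spell_repetitive:
  fixes w :: "nat \<Rightarrow> 'a list" and \<kappa> :: "nat \<Rightarrow> nat" and \<alpha> :: "nat \<Rightarrow> 'a list"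
  assumes w: "\<And>n. w (Suc n) = concat (replicate (\<kappa> n) (w n)) @ \<alpha> n"
    and pos: "\<And>n. w n \<noteq> []" "\<And>n. 0 < \<kappa> n"
    and "n \<le> m"
  shows "\<exists>ts. map fst (spell (w n) ts) = w m \<and>
    num_spacers (spell (w n) ts) \<le> (\<Sum>i=n..<m. length (\<alpha> i) / (real (\<kappa> i) * real (length (w i)))) * length (w m)"
  using \<open>n \<le> m\<close>
proof (induction m rule: dec_induct)
  case base
  have "map fst (spell (w n) [None]) = w n" "num_spacers (spell (w n) [None]) = 0"
    by (simp_all add: comp_def num_spacers_unmarked)
  then show ?case by fastforce
next
  case (step m)
  then obtain ts where ts: "map fst (spell (w n) ts) = w m"
    "num_spacers (spell (w n) ts) \<le> (\<Sum>i=n..<m. length (\<alpha> i) / (real (\<kappa> i) * real (length (w i)))) * length (w m)"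
    by blast
  let ?ts = "concat (replicate (\<kappa> m) ts) @ map Some (\<alpha> m)"
  let ?S = "\<Sum>i=n..<m. length (\<alpha> i) / (real (\<kappa> i) * real (length (w i))) :: real"
  have "map fst (concat (replicate K (spell (w n) ts))) = concat (replicate K (w m))"
    and "num_spacers (concat (replicate K (spell (w n) ts))) = K * num_spacers (spell (w n) ts)" for K
    by (induction K) (simp_all add: ts)
  then have 1: "map fst (spell (w n) ?ts) = w (Suc m)"
    and 2: "num_spacers (spell (w n) ?ts) = \<kappa> m * num_spacers (spell (w n) ts) + length (\<alpha> m)"
    by (simp_all add: spell_concat_replicate spell_map_Some w comp_def)
  have S: "0 \<le> ?S" by (intro sum_nonneg) simp
  have "real (num_spacers (spell (w n) ?ts)) \<le> \<kappa> m * (?S * length (w m)) + length (\<alpha> m)"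
    using ts(2) unfolding 2 by (simp add: mult_left_mono)
  also have "\<dots> = (?S + length (\<alpha> m) / (\<kappa> m * length (w m))) * (\<kappa> m * length (w m))"
    using pos by (simp add: field_simps)
  also have "\<dots> \<le> (?S + length (\<alpha> m) / (\<kappa> m * length (w m))) * length (w (Suc m))"
    using S by (intro mult_left_mono add_nonneg_nonneg) (auto simp: w length_concat_replicate)
  also have "?S + length (\<alpha> m) / (\<kappa> m * length (w m)) = (\<Sum>i=n..<Suc m. length (\<alpha> i) / (real (\<kappa> i) * real (length (w i))))"
    using step(1) by simp
  finally show ?case using 1 by blast
qed

section \<open>Circle maps and orbit measures\<close>

text \<open>
  Away from \<open>D\<close>, the value at \<open>t\<close> is determined by the number of points of \<open>D\<close> below \<open>t\<close>.
\<close>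

lemma card_piecewise_constant:
  fixes g :: "real \<Rightarrow> 'b"
  assumes D: "finite D"
    and const: "\<And>s t. s \<in> I \<Longrightarrow> t \<in> I \<Longrightarrow> s \<le> t \<Longrightarrow> {s..t} \<inter> D = {} \<Longrightarrow> g s = g t"
  shows "finite (g ` I)" "card (g ` I) \<le> 2 * card D + 1"
proof -
  define c where "c t = card {x \<in> D. x < t}" for t
  have eq: "g s = g t" if "s \<in> I - D" "t \<in> I - D" "c s = c t" "s \<le> t" for s t
  proof (rule const)
    have "{x \<in> D. x < s} = {x \<in> D. x < t}"
      using that D by (intro card_subset_eq) (auto simp: c_def)
    moreover have "x \<noteq> s" "x \<noteq> t" if "x \<in> D" for x
      using \<open>s \<in> I - D\<close> \<open>t \<in> I - D\<close> that by auto
    ultimately have "x < s \<or> t < x" if "x \<in> D" for x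
      using that by (metis (mono_tags, lifting) antisym_conv3 mem_Collect_eq)
    then show "{s..t} \<inter> D = {}"
      by (metis (no_types, lifting) atLeastAtMost_iff disjoint_iff not_le)
  qed (use that in auto)
  have eq: "g s = g t" if "s \<in> I - D" "t \<in> I - D" "c s = c t" for s t
    using that by (metis eq linear)
  \<comment> \<open>\<open>h m\<close> is the common value of \<open>g\<close> at the points off
    \<open>D\<close> with exactly \<open>m\<close> points of \<open>D\<close> below. This gives at
    most \<open>card D + 1\<close> values, and the points of \<open>D\<close> themselves add at most
    \<open>card D\<close>.\<close>
  define h where "h m = g (SOME t. t \<in> I - D \<and> c t = m)" for m
  have "g t = h (c t)" if "t \<in> I - D" for t
    unfolding h_def using that by (intro eq) (metis (mono_tags, lifting) someI_ex)+
  moreover have "c t \<le> card D" for t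
    unfolding c_def using D by (intro card_mono) auto
  ultimately have sub: "g ` I \<subseteq> g ` D \<union> h ` {..card D}"
    by force
  then show "finite (g ` I)"
    by (rule finite_subset) (use D in simp)
  have "card (g ` I) \<le> card (g ` D \<union> h ` {..card D})"
    using D sub by (intro card_mono) auto
  also have "\<dots> \<le> card (g ` D) + card (h ` {..card D})"
    by (rule card_Un_le)
  also have "\<dots> \<le> card D + card {..card D}"
    using D by (intro add_mono card_image_le) auto
  finally show "card (g ` I) \<le> 2 * card D + 1" by simp
qed

lemma circle_eq_cis_image: "circle = cis ` {0..<2 * pi}"
proof (intro equalityI subsetI)
  fix z assume "z \<in> circle"
  then have "z = cis (Arg2pi z)"
    using Arg2pi[of z] by (simp add: is_Arg_def cis_conv_exp mult.commute)
  then show "z \<in> cis ` {0..<2 * pi}"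
    using Arg2pi[of z] by auto
qed auto

lemma inj_on_cis: "inj_on cis {0..<2 * pi}"
  by (rule inj_on_inverseI[where g=Arg2pi])
    (auto intro: Arg2pi_unique[where r=1] simp: cis_conv_exp)

text \<open>The hypothesis concerns \<open>h \<circ> cis\<close> on the line, so continuity is
  transported through local inverses of \<open>cis\<close>. \<open>Arg (cis s * z) - s\<close> is a
  continuous argument of \<open>z\<close> off the point where \<open>cis s * z = -1\<close>; the
  arcs for \<open>s = 0\<close> and \<open>s = pi\<close> cover the circle.\<close>

lemma circle_C1_diffeo_continuous:
  assumes "circle_C1_diffeo h"
  shows "continuous_on circle h"
proof -
  have cont: "continuous_on UNIV (\<lambda>t. h (cis t))"
    using assms C1_differentiable_imp_continuous_on by (auto simp: circle_C1_diffeo_def)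
  let ?U = "\<lambda>s. {z \<in> circle. s * z \<notin> \<real>\<^sub>\<le>\<^sub>0}"
  have 1: "continuous_on (?U (cis s)) h" for s
  proof -
    have "continuous_on (?U (cis s)) (\<lambda>z. h (cis (Arg (cis s * z) - s)))"
      by (intro continuous_on_compose2[OF cont] continuous_intros) auto
    moreover have "cis (Arg (cis s * z) - s) = z" if "z \<in> circle" for z
    proof -
      have "cis (Arg (cis s * z)) = cis s * z"
        using that by (subst cis_Arg) (auto simp: sgn_eq norm_mult)
      then show ?thesis
        by (metis cis_divide cis_neq_zero nonzero_mult_div_cancel_left)
    qed
    ultimately show ?thesis
      by (subst (asm) continuous_on_cong[OF refl, where g=h]) auto
  qed
  have op: "openin (top_of_set circle) (?U s)" for s
  proof -
    have "?U s = circle \<inter> (\<lambda>z. s * z) -` (- \<real>\<^sub>\<le>\<^sub>0)" by auto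
    moreover have "open ((\<lambda>z. s * z) -` (- \<real>\<^sub>\<le>\<^sub>0))"
      by (intro open_vimage) (auto intro!: continuous_intros)
    ultimately show ?thesis by (simp add: openin_open_Int)
  qed
  have un: "?U (cis 0) \<union> ?U (cis pi) = circle"
    by (auto simp: complex_nonpos_Reals_iff cmod_def)
  have "continuous_on (?U (cis 0) \<union> ?U (cis pi)) h"
    by (rule continuous_on_Un_local_open[OF _ _ 1 1]) (simp_all only: un op)
  then show ?thesis by (simp only: un)
qed

text \<open>By injectivity every point of \<open>E\<close> has at most one preimage under each
  \<open>F i\<close>, which makes at most \<open>N * card E\<close> cuts in the parameter interval.
  Between cuts the image of an arc under \<open>F i\<close> is connected and misses
  \<open>E\<close>, so it lies inside or outside \<open>B\<close>.\<close>

lemma card_circle_names: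
  assumes E: "finite E"
    and B: "\<And>S. connected S \<Longrightarrow> S \<subseteq> circle \<Longrightarrow> S \<inter> E = {} \<Longrightarrow> S \<subseteq> B \<or> S \<inter> B = {}"
    and F: "\<And>i. i < N \<Longrightarrow> continuous_on circle (F i)" "\<And>i. i < N \<Longrightarrow> F i ` circle \<subseteq> circle"
      "\<And>i. i < N \<Longrightarrow> inj_on (F i) circle"
  shows "finite ((\<lambda>z. map (\<lambda>i. F i z \<in> B) [0..<N]) ` circle)"
    and "card ((\<lambda>z. map (\<lambda>i. F i z \<in> B) [0..<N]) ` circle) \<le> 2 * (N * card E) + 1"
proof -
  let ?I = "{0..<2 * pi}"
  define D where "D i = {t \<in> ?I. F i (cis t) \<in> E}" for i
  have cis: "cis ` ?I \<subseteq> circle" by auto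
  have inj: "inj_on (\<lambda>t. F i (cis t)) ?I" if "i < N" for i
    using comp_inj_on[OF inj_on_cis inj_on_subset[OF F(3)[OF that] cis]] by (simp add: comp_def)
  have D: "finite (D i)" "card (D i) \<le> card E" if "i < N" for i
  proof -
    have "inj_on (\<lambda>t. F i (cis t)) (D i)" "(\<lambda>t. F i (cis t)) ` D i \<subseteq> E"
      by (rule inj_on_subset[OF inj[OF that]]) (auto simp: D_def)
    then show "finite (D i)" "card (D i) \<le> card E"
      using E by (auto intro: inj_on_finite card_inj_on_le)
  qed
  define D' where "D' = (\<Union>i<N. D i)"
  have fin: "finite D'" using D by (auto simp: D'_def)
  have "card D' \<le> (\<Sum>i<N. card (D i))"
    unfolding D'_def by (rule card_UN_le) simp
  also have "\<dots> \<le> (\<Sum>i<N. card E)"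
    using D by (intro sum_mono) auto
  finally have card: "card D' \<le> N * card E" by simp
  let ?g = "\<lambda>t. map (\<lambda>i. F i (cis t) \<in> B) [0..<N]"
  have const: "?g s = ?g t" if "s \<in> ?I" "t \<in> ?I" "s \<le> t" "{s..t} \<inter> D' = {}" for s t
  proof (rule map_cong[OF refl])
    fix i assume "i \<in> set [0..<N]"
    then have i: "i < N" by simp
    let ?S = "(\<lambda>t. F i (cis t)) ` {s..t}"
    have "continuous_on {s..t} (\<lambda>t. F i (cis t))"
      by (rule continuous_on_compose2[OF F(1)[OF i]]) (auto intro!: continuous_intros)
    then have "connected ?S"
      by (rule connected_continuous_image) simp
    moreover have "?S \<subseteq> circle"
      using F(2)[OF i] by force
    moreover have "F i (cis r) \<notin> E" if r: "r \<in> {s..t}" for r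
    proof
      assume "F i (cis r) \<in> E"
      moreover have "r \<in> ?I"
        using r \<open>s \<in> ?I\<close> \<open>t \<in> ?I\<close> by auto
      ultimately have "r \<in> D'"
        using i by (auto simp: D'_def D_def)
      then show False
        using r \<open>{s..t} \<inter> D' = {}\<close> by blast
    qed
    then have "?S \<inter> E = {}"
      by blast
    ultimately have "?S \<subseteq> B \<or> ?S \<inter> B = {}"
      by (rule B)
    moreover have "F i (cis s) \<in> ?S" "F i (cis t) \<in> ?S"
      using that(3) by auto
    ultimately show "F i (cis s) \<in> B \<longleftrightarrow> F i (cis t) \<in> B"
      by blast
  qed
  have im: "(\<lambda>z. map (\<lambda>i. F i z \<in> B) [0..<N]) ` circle = ?g ` ?I"
    unfolding circle_eq_cis_image image_image ..
  show "finite ((\<lambda>z. map (\<lambda>i. F i z \<in> B) [0..<N]) ` circle)"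
    unfolding im using fin const by (rule card_piecewise_constant(1))
  have "card (?g ` ?I) \<le> 2 * card D' + 1"
    using fin const by (rule card_piecewise_constant(2))
  then show "card ((\<lambda>z. map (\<lambda>i. F i z \<in> B) [0..<N]) ` circle) \<le> 2 * (N * card E) + 1"
    unfolding im using card by linarith
qed

lemma connected_halfspace:
  fixes h :: "'a :: topological_space \<Rightarrow> real"
  assumes "connected S" "continuous_on S h" "a \<notin> h ` S"
  shows "S \<subseteq> {z. h z \<le> a} \<or> S \<inter> {z. h z \<le> a} = {}"
proof (rule ccontr)
  assume "\<not> ?thesis"
  then obtain x y where "x \<in> S" "y \<in> S" "h x \<le> a" "a \<le> h y" by force
  moreover have "connected (h ` S)"
    using assms by (intro connected_continuous_image)
  ultimately have "a \<in> h ` S"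
    unfolding connected_iff_interval by blast
  then show False using assms(3) by simp
qed

lemma finite_circle_Re: "finite {z \<in> circle. Re z = a}"
proof (rule finite_subset)
  show "{z \<in> circle. Re z = a} \<subseteq> Complex a ` {sqrt (1 - a\<^sup>2), - sqrt (1 - a\<^sup>2)}"
  proof
    fix z assume "z \<in> {z \<in> circle. Re z = a}"
    then have z: "(Im z)\<^sup>2 = 1 - a\<^sup>2" "Re z = a"
      by (auto simp: cmod_def)
    then have "\<bar>Im z\<bar> = sqrt (1 - a\<^sup>2)"
      by (metis real_sqrt_abs)
    then show "z \<in> Complex a ` {sqrt (1 - a\<^sup>2), - sqrt (1 - a\<^sup>2)}"
      using z(2) by (auto simp: complex_eq_iff abs_if split: if_splits)
  qed
qed simp

lemma finite_circle_Im: "finite {z \<in> circle. Im z = a}"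
proof (rule finite_subset)
  have "z = \<i> * (- \<i> * z)" for z by (simp add: complex_eq_iff)
  then show "{z \<in> circle. Im z = a} \<subseteq> (*) \<i> ` {z \<in> circle. Re z = a}"
    by (auto simp: norm_mult intro!: image_eqI[where x="- \<i> * _"])
qed (use finite_circle_Re in simp)

section \<open>Words read along orbits of the skew product\<close>

lemma skew_map_funpow:
  "(skew_map f ^^ i) (\<xi>, x) = (\<lambda>j. \<xi> (j + int i), fold f (map (\<lambda>m. \<xi> (int m)) [0..<i]) x)"
  by (induction i) (simp_all add: skew_map_def shift_map_def add_ac)

lemma itinerary_symbol:
  "itinerary (skew_map f) (\<lambda>p. fst p 0) N p = map (\<lambda>i. fst p (int i)) [0..<N]"
  by (cases p) (simp add: itinerary_def skew_map_funpow)

text \<open>Symbols are discrete, so a function of finitely many coordinates is locally constant,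
  whatever \<open>G\<close> is. This makes code lengths admissible test functions for weak-star
  convergence.\<close>

lemma continuous_on_word:
  fixes G :: "nat list \<Rightarrow> 'b :: topological_space"
  shows "continuous_on S (\<lambda>p :: (int \<Rightarrow> nat) \<times> 'a :: topological_space. G (map (\<lambda>i. fst p (int i)) [0..<N]))"
  unfolding continuous_on_def
proof
  fix p :: "(int \<Rightarrow> nat) \<times> 'a" assume "p \<in> S"
  have "continuous_on S (\<lambda>p. fst p j)" for j
    by (rule continuous_on_product_then_coordinatewise) (rule continuous_on_fst[OF continuous_on_id])
  then have "((\<lambda>p. fst p j) \<longlongrightarrow> fst p j) (at p within S)" for j
    using \<open>p \<in> S\<close> by (simp add: continuous_on_def)
  then have "\<forall>\<^sub>F q in at p within S. fst q j = fst p j" for j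
    by (simp only: tendsto_discrete)
  then have "\<forall>\<^sub>F q in at p within S. \<forall>i\<in>{..<N}. fst q (int i) = fst p (int i)"
    by (intro eventually_ball_finite) auto
  then have "\<forall>\<^sub>F q in at p within S. G (map (\<lambda>i. fst q (int i)) [0..<N]) = G (map (\<lambda>i. fst p (int i)) [0..<N])"
    by (rule eventually_mono) (auto intro!: arg_cong[where f=G])
  then show "((\<lambda>p. G (map (\<lambda>i. fst p (int i)) [0..<N])) \<longlongrightarrow>
      G (map (\<lambda>i. fst p (int i)) [0..<N])) (at p within S)"
    by (rule tendsto_eventually)
qed

lemma integral_orbit_measure:
  fixes \<Phi> :: "'a \<Rightarrow> real"
  assumes "\<And>l. l < p \<Longrightarrow> (T ^^ l) x \<in> space N" and "\<Phi> \<in> borel_measurable N"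
  shows "integral\<^sup>L (orbit_measure N T x p) \<Phi> = (\<Sum>l<p. \<Phi> ((T ^^ l) x)) / p"
proof -
  have "(\<lambda>l. (T ^^ l) x) \<in> uniform_count_measure {..<p} \<rightarrow>\<^sub>M N"
    using assms(1) by (auto simp: measurable_def space_uniform_count_measure sets_uniform_count_measure)
  then show ?thesis
    unfolding orbit_measure_def using assms(2)
    by (simp add: integral_distr integral_uniform_count_measure)
qed

section \<open>The skew product\<close>

lemma fold_circle:
  assumes "\<And>i. i \<in> {1..k} \<Longrightarrow> circle_C1_diffeo (f i)" and "set v \<subseteq> {1..k}"
  shows "continuous_on circle (fold f v) \<and> fold f v ` circle = circle \<and> inj_on (fold f v) circle"
  using assms(2)
proof (induction v)
  case Nil
  then show ?case by simp
next
  case (Cons a v)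
  have h: "circle_C1_diffeo (f a)" using Cons.prems assms(1) by simp
  then have b: "f a ` circle = circle" "inj_on (f a) circle"
    by (simp_all add: circle_C1_diffeo_def bij_betw_def)
  have IH: "continuous_on circle (fold f v)" "fold f v ` circle = circle" "inj_on (fold f v) circle"
    using Cons by auto
  have "continuous_on circle (fold f v \<circ> f a)"
    by (rule continuous_on_compose[OF circle_C1_diffeo_continuous[OF h]]) (simp only: b IH)
  moreover have "inj_on (fold f v \<circ> f a) circle"
    by (rule comp_inj_on[OF b(2)]) (simp only: b IH)
  moreover have "(fold f v \<circ> f a) ` circle = circle"
    by (simp only: image_comp[symmetric] b IH)
  ultimately show ?case by (simp add: comp_def)
qed

text \<open>For a preimage of \<open>(\<xi>, x)\<close>, shift \<open>\<xi>\<close> back, which puts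
  \<open>\<xi> (- 1)\<close> at coordinate 0, and solve \<open>f (\<xi> (- 1)) y = x\<close> on the
  circle.\<close>

lemma skew_map_image:
  assumes "\<And>i. i \<in> {1..k} \<Longrightarrow> circle_C1_diffeo (f i)"
  shows "skew_map f ` skew_space k = skew_space k"
proof -
  have b: "f i ` circle = circle" if "i \<in> {1..k}" for i
    using assms[OF that] by (simp add: circle_C1_diffeo_def bij_betw_def)
  show ?thesis
  proof (intro equalityI subsetI)
    fix p assume "p \<in> skew_map f ` skew_space k"
    then obtain \<xi> x where p: "p = skew_map f (\<xi>, x)" "\<xi> \<in> full_shift k" "x \<in> circle"
      by (auto simp: skew_space_def)
    then have "f (\<xi> 0) x \<in> circle"
      using b[of "\<xi> 0"] by (auto simp: full_shift_def)
    then show "p \<in> skew_space k"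
      using p by (auto simp: skew_space_def skew_map_def shift_map_def full_shift_def)
  next
    fix p assume "p \<in> skew_space k"
    then obtain \<xi> x where p: "p = (\<xi>, x)" "\<xi> \<in> full_shift k" "x \<in> circle"
      by (auto simp: skew_space_def)
    let ?\<eta> = "\<lambda>j. \<xi> (j - 1)"
    have \<eta>: "?\<eta> \<in> full_shift k"
      using p by (simp add: full_shift_def)
    then have "?\<eta> 0 \<in> {1..k}"
      unfolding full_shift_def by blast
    then have "x \<in> f (?\<eta> 0) ` circle"
      using p(3) by (simp only: b)
    then obtain y where "y \<in> circle" "x = f (?\<eta> 0) y"
      by (rule imageE)
    then show "p \<in> skew_map f ` skew_space k"
      using \<eta> p by (intro image_eqI[where x="(?\<eta>, y)"])
        (auto simp: skew_space_def skew_map_def shift_map_def)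
  qed
qed

locale skew_product = measure_preserving_surjection M "skew_map f" for k f and M :: "((int \<Rightarrow> nat) \<times> complex) measure" +
  assumes sets_M: "sets M = sets (skew_borel k)"
    and diffeo: "\<And>i. i \<in> {1..k} \<Longrightarrow> circle_C1_diffeo (f i)"
begin

lemma space_M: "space M = skew_space k"
  using sets_eq_imp_space_eq[OF sets_M] by (simp add: skew_borel_def space_restrict_space)

lemma borel_measurable_M: "g \<in> borel_measurable borel \<Longrightarrow> g \<in> borel_measurable M"
  unfolding measurable_cong_sets[OF sets_M refl] skew_borel_def
  by (rule measurable_restrict_space1)

lemma simple_symbol: "simple_function M (\<lambda>p. fst p j)"
proof (rule simple_function_borel_measurable)
  have "continuous_on UNIV (\<lambda>p :: (int \<Rightarrow> nat) \<times> complex. fst p j)"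
    by (rule continuous_on_product_then_coordinatewise) (rule continuous_on_fst[OF continuous_on_id])
  then show "(\<lambda>p. fst p j) \<in> borel_measurable M"
    by (intro borel_measurable_M borel_measurable_continuous_onI)
  have "(\<lambda>p. fst p j) ` space M \<subseteq> {1..k}"
    by (auto simp: space_M skew_space_def full_shift_def)
  then show "finite ((\<lambda>p. fst p j) ` space M)"
    by (rule finite_subset) simp
qed

text \<open>Code the word first by the block code and then choose uniformly among at most
  \<open>c N\<close> names of \<open>B\<close> that occur with this word. The second part costs
  \<open>ln (c N)\<close>, which is \<open>O(ln N)\<close>. The block \<open>w\<close> may depend on
  \<open>\<epsilon>\<close>, but not on \<open>N\<close>.\<close>

lemma cheap_symbol_and_set:
  assumes E: "finite E" and B: "B \<in> sets borel"
    and conn: "\<And>S. connected S \<Longrightarrow> S \<subseteq> circle \<Longrightarrow> S \<inter> E = {} \<Longrightarrow> S \<subseteq> B \<or> S \<inter> B = {}"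
    and cost: "\<And>\<epsilon> :: real. 0 < \<epsilon> \<Longrightarrow> \<exists>w. w \<noteq> [] \<and>
      (\<forall>\<^sub>F N in sequentially. (\<integral>p. block_cost k w (itinerary (skew_map f) (\<lambda>p. fst p 0) N p) \<partial>M) \<le> \<epsilon> * N)"
  shows "cheap (\<lambda>p. (fst p 0, snd p \<in> B))"
proof -
  let ?T = "skew_map f"
  let ?\<phi> = "\<lambda>p :: (int \<Rightarrow> nat) \<times> complex. fst p 0"
  let ?\<theta> = "\<lambda>p :: (int \<Rightarrow> nat) \<times> complex. (fst p 0, snd p \<in> B)"
  have k: "0 < k"
    using not_empty by (auto simp: space_M skew_space_def full_shift_def)
  have "snd \<in> borel_measurable M"
    by (intro borel_measurable_M borel_measurable_continuous_onI continuous_on_snd continuous_on_id)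
  then have "snd -` B \<inter> space M \<in> events"
    using B by (rule measurable_sets)
  then have "simple_function M (\<lambda>p. p \<in> snd -` B \<inter> space M)"
    by (rule simple_function_member)
  then have "simple_function M (\<lambda>p. snd p \<in> B)"
    by (subst simple_function_cong[where g="\<lambda>p. p \<in> snd -` B \<inter> space M"]) auto
  then have sf: "simple_function M ?\<theta>"
    using simple_symbol by (intro simple_function_Pair)
  have fst_itin: "map fst (itinerary ?T ?\<theta> N p) = itinerary ?T ?\<phi> N p" for N p
    by (simp add: itinerary_def)
  have sub: "itins ?\<phi> N \<subseteq> {u. set u \<subseteq> {1..k} \<and> length u = N}" for N
    unfolding itinerary_symbol by (auto simp: space_M skew_space_def full_shift_def)
  define c where "c N = 2 * (N * card E) + 1" for N
  have card: "card {u \<in> itins ?\<theta> N. map fst u = v} \<le> c N" if v: "v \<in> itins ?\<phi> N" for N v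
  proof -
    let ?names = "(\<lambda>z. map (\<lambda>i. fold f (take i v) z \<in> B) [0..<N]) ` circle"
    have "set (take i v) \<subseteq> {1..k}" for i
      using v sub[of N] set_take_subset[of i v] by auto
    note F = fold_circle[OF diffeo this]
    have names: "finite ?names" "card ?names \<le> c N"
      unfolding c_def using F by (intro card_circle_names[OF E conn]; simp)+
    have "{u \<in> itins ?\<theta> N. map fst u = v} \<subseteq> zip v ` ?names"
    proof
      fix u assume "u \<in> {u \<in> itins ?\<theta> N. map fst u = v}"
      then obtain \<xi> x where p: "(\<xi>, x) \<in> space M" "u = itinerary ?T ?\<theta> N (\<xi>, x)" "map fst u = v"
        by auto
      have "v = map (\<lambda>i. \<xi> (int i)) [0..<N]"
        using p(3) unfolding p(2) fst_itin itinerary_symbol by simp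
      \<comment> \<open>The fibre map at time \<open>i\<close> uses only the symbols at
        \<open>0, ..., i - 1\<close>, that is \<open>take i v\<close>; so the name of
        \<open>(\<xi>, x)\<close> is a function of \<open>v\<close> and \<open>x\<close>.\<close>
      then have "take i v = map (\<lambda>m. \<xi> (int m)) [0..<i]" if "i < N" for i
        using that by (simp add: take_map)
      then have "map snd u = map (\<lambda>i. fold f (take i v) x \<in> B) [0..<N]"
        by (simp add: p(2) itinerary_def skew_map_funpow)
      moreover have "u = zip v (map snd u)"
        using p(3) by (metis zip_map_fst_snd)
      moreover have "x \<in> circle"
        using p(1) by (simp add: space_M skew_space_def)
      ultimately show "u \<in> zip v ` ?names" by blast
    qed
    then have "card {u \<in> itins ?\<theta> N. map fst u = v} \<le> card (zip v ` ?names)"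
      using names by (intro card_mono) auto
    also have "\<dots> \<le> c N"
      using card_image_le[OF names(1), of "zip v"] names(2) by linarith
    finally show ?thesis .
  qed
  show ?thesis
    unfolding cheap_def codable_def
  proof (intro allI impI conjI sf)
    fix \<epsilon> :: real assume \<epsilon>: "0 < \<epsilon>"
    then obtain w where w: "w \<noteq> []" and
      ev: "\<forall>\<^sub>F N in sequentially. (\<integral>p. block_cost k w (itinerary ?T ?\<phi> N p) \<partial>M) \<le> \<epsilon> / 2 * N"
      using cost[of "\<epsilon> / 2"] by auto
    \<comment> \<open>For \<open>N > 0\<close>, \<open>c N \<le> (2 * card E + 1) * N\<close>, so
      this sequence bounds \<open>ln (c N) / N\<close>.\<close>
    have "(\<lambda>N. ln (2 * card E + 1) * inverse (real N) + ln (real N) / real N) \<longlonglongrightarrow> ln (2 * card E + 1) * 0 + 0"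
      by (intro tendsto_intros lim_inverse_n)
    then have "\<forall>\<^sub>F N in sequentially. ln (2 * card E + 1) * inverse (real N) + ln (real N) / real N < \<epsilon> / 2"
      using \<epsilon> by (intro order_tendstoD(2)) auto
    then show "\<forall>\<^sub>F N in sequentially. codable_at ?\<theta> N (\<epsilon> * N)"
      using ev eventually_gt_at_top[of 0]
    proof eventually_elim
      case (elim N)
      let ?Q = "\<lambda>u. block_code k w (map fst u) / c N"
      have c: "0 < c N" by (simp add: c_def)
      have pos: "0 < block_code k w u" for u by (rule block_code_pos[OF k])
      note fin = finite_itins[OF sf, of N]
      show ?case
      proof (rule codable_atI[where Q="?Q"])
        show "0 < ?Q (itinerary ?T ?\<theta> N p)" for p
          using c by (simp add: pos)
        have im: "map fst ` itins ?\<theta> N = itins ?\<phi> N"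
          by (simp add: image_image fst_itin)
        have "sum ?Q (itins ?\<theta> N) = (\<Sum>v\<in>itins ?\<phi> N. \<Sum>u | u \<in> itins ?\<theta> N \<and> map fst u = v. ?Q u)"
          using sum.image_gen[OF fin, of ?Q "map fst"] unfolding im .
        also have "\<dots> = (\<Sum>v\<in>itins ?\<phi> N. card {u \<in> itins ?\<theta> N. map fst u = v} * (block_code k w v / c N))"
          by (intro sum.cong refl) simp
        also have "\<dots> \<le> (\<Sum>v\<in>itins ?\<phi> N. c N * (block_code k w v / c N))"
          using card by (intro sum_mono mult_right_mono divide_nonneg_nonneg less_imp_le[OF pos]) auto
        also have "\<dots> = sum (block_code k w) (itins ?\<phi> N)"
          using c by simp
        also have "\<dots> \<le> sum (block_code k w) {u. set u \<subseteq> {1..k} \<and> length u = N}"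
          using sub pos by (intro sum_mono2 finite_lists_length_eq) (auto intro: less_imp_le)
        also have "\<dots> \<le> 1"
          using sum_block_code[of "{1..k}" w N] k w by simp
        finally show "sum ?Q (itins ?\<theta> N) \<le> 1" .
        have "(\<integral>p. - ln (?Q (itinerary ?T ?\<theta> N p)) \<partial>M) =
            (\<integral>p. block_cost k w (itinerary ?T ?\<phi> N p) + ln (c N) \<partial>M)"
          using c pos by (simp add: fst_itin block_cost_def ln_divide_pos)
        also have "\<dots> = (\<integral>p. block_cost k w (itinerary ?T ?\<phi> N p) \<partial>M) + ln (c N)"
          using integrable_itinerary[OF simple_symbol, of "block_cost k w" 0 N]
          by (simp add: prob_space)
        also have "ln (c N) \<le> ln ((2 * card E + 1) * real N)"
        proof (rule ln_mono)
          have "c N \<le> (2 * card E + 1) * N"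
            using elim(3) by (simp add: c_def distrib_right)
          then show "real (c N) \<le> (2 * card E + 1) * real N"
            by (metis of_nat_le_iff of_nat_mult)
        qed (use c in simp)
        also have "ln ((2 * card E + 1) * real N) = ln (2 * card E + 1) + ln N"
          using elim(3) by (intro ln_mult_pos) auto
        also have "\<dots> = (ln (2 * card E + 1) * inverse (real N) + ln (real N) / real N) * N"
          using elim(3) by (simp add: distrib_right)
        also have "\<dots> \<le> \<epsilon> / 2 * N"
          by (rule mult_right_mono[OF less_imp_le[OF elim(1)]]) simp
        finally show "(\<integral>p. - ln (?Q (itinerary ?T ?\<theta> N p)) \<partial>M) \<le> \<epsilon> * N"
          using elim(2) by simp
      qed
    qed
  qed
qed

text \<open>For a fixed large \<open>n\<close>, all words \<open>w m\<close> with
  \<open>m \<ge> n\<close> are parsed into copies of \<open>w n\<close> with few spacers. The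
  average cost of a window over the orbit of stage \<open>m\<close> is then bounded independently of
  \<open>m\<close>.\<close>

lemma block_cost_repetitive_pattern:
  fixes \<epsilon> :: real
  assumes prp: "periodic_repetitive_pattern k f M" and \<epsilon>: "0 < \<epsilon>"
  shows "\<exists>w. w \<noteq> [] \<and>
      (\<forall>\<^sub>F N in sequentially. (\<integral>p. block_cost k w (itinerary (skew_map f) (\<lambda>p. fst p 0) N p) \<partial>M) \<le> \<epsilon> * N)"
proof -
  let ?T = "skew_map f"
  obtain \<xi> q w where pat: "repetitive_pattern k f \<xi> q w"
    and conv: "weak_star_convergent (skew_space k)
      (\<lambda>n. orbit_measure (skew_borel k) ?T (\<xi> n, q n) (length (w n))) M"
    using prp unfolding periodic_repetitive_pattern_def by blast
  have base: "\<And>n. (\<xi> n, q n) \<in> skew_space k" "\<And>n. w n \<noteq> []" "\<And>n. set (w n) \<subseteq> {1..k}"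
    "\<And>n. \<xi> n = generated_by (w n)"
    using conjunct1[OF pat[unfolded repetitive_pattern_def]] by blast+
  obtain \<kappa> :: "nat \<Rightarrow> nat" and \<alpha> :: "nat \<Rightarrow> nat list"
    where rec: "\<And>n. 1 \<le> length (\<alpha> (Suc n))" "\<And>n. 2 \<le> \<kappa> (Suc n)"
      "\<And>n. w (Suc n) = concat (replicate (\<kappa> (Suc n)) (w n)) @ \<alpha> (Suc n)"
    and summ: "summable (\<lambda>n. real (length (\<alpha> (Suc n))) / (real (\<kappa> (Suc n)) * real (length (w n))))"
    using pat unfolding repetitive_pattern_def by blast
  have k: "0 < k"
    using base(2,3)[of 0] by (cases "w 0") auto
  define C where "C = ln (2 * real k)"
  have C: "0 < C" using k by (simp add: C_def)
  \<comment> \<open>Each stage repeats the word and appends a nonempty one, so the lengths strictly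
    increase: a price of \<open>ln 2\<close> per copy becomes negligible per letter.\<close>
  have len: "n \<le> length (w n)" for n
  proof (induction n)
    case (Suc n)
    have "1 * length (w n) \<le> \<kappa> (Suc n) * length (w n)"
      using rec(2)[of n] by (intro mult_right_mono) auto
    then show ?case
      using Suc rec(1)[of n] unfolding rec(3) length_append length_concat_replicate by linarith
  qed simp
  \<comment> \<open>The budget per letter: \<open>C * \<delta> = \<epsilon> / 4\<close> for spacers,
    \<open>ln 2 / L \<le> \<epsilon> / 4\<close> for copies, and \<open>\<epsilon> / 2\<close> for
    the cut ends, which suffices once \<open>N \<ge> N0\<close>.\<close>
  define \<delta> where "\<delta> = \<epsilon> / (4 * C)"
  have "0 < \<delta>" using \<epsilon> C by (simp add: \<delta>_def)
  define r where "r i = real (length (\<alpha> (Suc i))) / (real (\<kappa> (Suc i)) * real (length (w i)))" for i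
  obtain n1 where n1: "norm (sum r {m..<m'}) < \<delta>" if "n1 \<le> m" for m m'
    using summ \<open>0 < \<delta>\<close> unfolding summable_Cauchy r_def by blast
  obtain n2 :: nat where n2: "4 * ln 2 / \<epsilon> \<le> n2"
    using real_arch_simple by blast
  define n where "n = Suc (max n1 n2)"
  have "n1 \<le> n" by (simp add: n_def)
  define L where "L = length (w n)"
  have L: "0 < L" using base(2) by (simp add: L_def)
  have "4 * ln 2 / \<epsilon> \<le> L"
    using n2 len[of n] by (simp add: n_def L_def)
  then have "ln 2 / L \<le> \<epsilon> / 4"
    using \<epsilon> L by (simp add: field_simps)
  have bound: "(\<integral>p. block_cost k (w n) (itinerary ?T (\<lambda>p. fst p 0) N p) \<partial>M) \<le>
      C * (N * \<delta> + 2 * L) + N / L * ln 2" for N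
  proof -
    let ?\<Phi> = "\<lambda>p :: (int \<Rightarrow> nat) \<times> complex. block_cost k (w n) (map (\<lambda>i. fst p (int i)) [0..<N])"
    have cont: "continuous_on (skew_space k) ?\<Phi>"
      by (rule continuous_on_word)
    \<comment> \<open>The integrals over the orbit measures converge to the one over
      \<open>M\<close>, so a bound valid for all \<open>m \<ge> n\<close> and free of
      \<open>m\<close> holds for \<open>M\<close>.\<close>
    have lim: "(\<lambda>m. integral\<^sup>L (orbit_measure (skew_borel k) ?T (\<xi> m, q m) (length (w m))) ?\<Phi>)
        \<longlonglongrightarrow> integral\<^sup>L M ?\<Phi>"
      using conv cont unfolding weak_star_convergent_def by blast
    have "integral\<^sup>L (orbit_measure (skew_borel k) ?T (\<xi> m, q m) (length (w m))) ?\<Phi> \<le>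
        C * (N * \<delta> + 2 * L) + N / L * ln 2" if m: "n \<le> m" for m
    proof -
      define p where "p = length (w m)"
      have p: "0 < p" using base(2) by (simp add: p_def)
      have "0 < \<kappa> (Suc i)" for i
        using rec(2)[of i] by linarith
      from ex_spell_repetitive[of w "\<lambda>n. \<kappa> (Suc n)" "\<lambda>n. \<alpha> (Suc n)", OF rec(3) base(2) this m, folded r_def]
      obtain ts where ts: "map fst (spell (w n) ts) = w m"
        "num_spacers (spell (w n) ts) \<le> sum r {n..<m} * length (w m)"
        by (elim exE conjE) (rule that)
      have "sum r {n..<m} \<le> \<delta>"
        using n1[OF \<open>n1 \<le> n\<close>, of m] by simp
      then have sp: "num_spacers (spell (w n) ts) \<le> \<delta> * p"
        using ts(2) mult_right_mono[of "sum r {n..<m}" \<delta> "real p"] by (simp add: p_def)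
      have "integral\<^sup>L (orbit_measure (skew_borel k) ?T (\<xi> m, q m) p) ?\<Phi> =
          (\<Sum>l<p. ?\<Phi> ((?T ^^ l) (\<xi> m, q m))) / p"
      proof (rule integral_orbit_measure)
        show "(?T ^^ l) (\<xi> m, q m) \<in> space (skew_borel k)" for l
          using T_pow_space[of "(\<xi> m, q m)" l] base(1)
          by (simp add: space_M skew_borel_def space_restrict_space)
        show "?\<Phi> \<in> borel_measurable (skew_borel k)"
          unfolding skew_borel_def using cont by (rule borel_measurable_continuous_on_restrict)
      qed
      \<comment> \<open>The \<open>l\<close>-th point of the orbit reads the periodic word from
        position \<open>l\<close> on, hence a cyclic window of \<open>w m\<close>.\<close>
      also have "(\<Sum>l<p. ?\<Phi> ((?T ^^ l) (\<xi> m, q m))) =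
          (\<Sum>l<p. block_cost k (w n) (map (\<lambda>i. w m ! ((l + i) mod p)) [0..<N]))"
      proof (intro sum.cong refl arg_cong[where f="block_cost k (w n)"] map_cong)
        show "fst ((?T ^^ l) (\<xi> m, q m)) (int i) = w m ! ((l + i) mod p)" for l i
        proof -
          have "nat ((int i + int l) mod int p) = (l + i) mod p"
            by (metis add.commute nat_int of_nat_add zmod_int)
          then show ?thesis
            by (simp add: skew_map_funpow base(4) generated_by_def p_def)
        qed
      qed
      also have "\<dots> \<le> C * (N * num_spacers (spell (w n) ts) + 2 * L * p) + p * N / L * ln 2"
        using sum_block_cost_periodic[OF k base(2) ts(1)[symmetric], of N]
        by (simp add: p_def C_def L_def)
      also have "\<dots> \<le> C * (N * (\<delta> * p) + 2 * L * p) + p * N / L * ln 2"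
        using mult_left_mono[OF sp, of "real N"] C by (intro add_mono mult_left_mono) auto
      also have "\<dots> = (C * (N * \<delta> + 2 * L) + N / L * ln 2) * p"
        by (simp add: algebra_simps)
      finally show ?thesis
        using p by (simp add: p_def divide_right_mono pos_divide_le_eq)
    qed
    then have "integral\<^sup>L M ?\<Phi> \<le> C * (N * \<delta> + 2 * L) + N / L * ln 2"
      by (intro LIMSEQ_le_const2[OF lim]) auto
    then show ?thesis by (simp only: itinerary_symbol)
  qed
  obtain N0 :: nat where N0: "4 * C * L / \<epsilon> \<le> N0"
    using real_arch_simple by blast
  have "(\<integral>p. block_cost k (w n) (itinerary ?T (\<lambda>p. fst p 0) N p) \<partial>M) \<le> \<epsilon> * N" if "N0 \<le> N" for N
  proof -
    have "4 * C * L / \<epsilon> \<le> N" using N0 that by linarith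
    then have "2 * C * L \<le> \<epsilon> / 2 * N"
      using \<epsilon> by (simp add: field_simps)
    moreover have "C * (N * \<delta>) = \<epsilon> / 4 * N"
      using C by (simp add: \<delta>_def)
    moreover have "N / L * ln 2 \<le> \<epsilon> / 4 * N"
      using mult_left_mono[OF \<open>ln 2 / L \<le> \<epsilon> / 4\<close>, of "real N"] by (simp add: mult.commute)
    moreover have "C * (N * \<delta> + 2 * L) = C * (N * \<delta>) + 2 * C * L"
      by (simp add: distrib_left)
    ultimately show ?thesis
      using bound[of N] by linarith
  qed
  then show ?thesis
    using base(2) unfolding eventually_sequentially by blast
qed

theorem ks_entropy_repetitive_pattern:
  assumes prp: "periodic_repetitive_pattern k f M"
  shows "ks_entropy M (skew_map f) = 0"
proof (rule ks_entropy_eq_0)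
  note cost = block_cost_repetitive_pattern[OF prp]
  \<comment> \<open>The cheap events as a measurable space: once the identity is measurable from
    \<open>N\<close> to \<open>skew_borel k\<close>, every event is cheap.\<close>
  define N where "N = sigma (space M) cheap_events"
  have N: "space N = skew_space k" "sets N = cheap_events"
    using sigma_algebra.sets_measure_of_eq[OF sigma_algebra_cheap_events]
      sigma_algebra.space_measure_of_eq[OF sigma_algebra_cheap_events]
    by (simp_all add: N_def space_M)
  \<comment> \<open>\<open>h\<close> will be \<open>Re\<close> or \<open>Im\<close>, whose level
    sets meet the circle in finitely many points; \<open>snd\<close> discards the symbol from the
    coded pair.\<close>
  have half: "{p \<in> space N. h (snd p) \<le> a} \<in> sets N"
    if h: "continuous_on UNIV h" "finite {z \<in> circle. h z = a}" for h :: "complex \<Rightarrow> real" and a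
  proof -
    have "cheap (\<lambda>p. (fst p 0, snd p \<in> {z. h z \<le> a}))"
    proof (rule cheap_symbol_and_set[OF h(2) _ _ cost])
      show "{z. h z \<le> a} \<in> sets borel"
        by (intro borel_closed closed_Collect_le h(1) continuous_on_const)
      show "S \<subseteq> {z. h z \<le> a} \<or> S \<inter> {z. h z \<le> a} = {}"
        if "connected S" "S \<subseteq> circle" "S \<inter> {z \<in> circle. h z = a} = {}" for S
        using that by (intro connected_halfspace continuous_on_subset[OF h(1)]) blast+
    qed
    from cheap_Collect[OF this, of snd] show ?thesis
      by (simp add: N space_M)
  qed
  \<comment> \<open>Coordinate 0 comes from the trivial set \<open>{}\<close> in the fibre; the
    shift equivalence carries it to all positive and negative coordinates.\<close>
  have symbol: "cheap (\<lambda>p. fst p j)" for j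
  proof (induction j rule: int_induct[where k=0])
    case base
    have "cheap (\<lambda>p. (fst p 0, snd p \<in> {}))"
      by (rule cheap_symbol_and_set[where E="{}", OF _ _ _ cost]) auto
    then show ?case
      using cheap_comp[where g=fst] by fastforce
  next
    case (step1 j)
    moreover have "(\<lambda>p. fst (skew_map f p) j) = (\<lambda>p. fst p (j + 1))"
      by (auto simp: skew_map_def shift_map_def)
    ultimately show ?case
      using cheap_shift[OF simple_symbol, of j] by simp
  next
    case (step2 j)
    moreover have "(\<lambda>p. fst (skew_map f p) (j - 1)) = (\<lambda>p. fst p j)"
      by (auto simp: skew_map_def shift_map_def)
    ultimately show ?case
      using cheap_shift[OF simple_symbol, of "j - 1"] by simp
  qed
  have fst: "fst \<in> N \<rightarrow>\<^sub>M borel"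
  proof -
    have "(\<lambda>p. fst p j) \<in> N \<rightarrow>\<^sub>M borel" for j
    proof -
      have "(\<lambda>p. fst p j) \<in> N \<rightarrow>\<^sub>M count_space UNIV"
        unfolding measurable_count_space_eq2_countable
      proof (intro CollectI conjI ballI)
        show "(\<lambda>p. fst p j) -` {a} \<inter> space N \<in> sets N" for a
          using cheap_Collect[OF symbol[of j], of "\<lambda>b. b = a"]
          by (simp add: N space_M vimage_def Int_def conj_commute)
      qed auto
      moreover have "(\<lambda>x. x) \<in> count_space (UNIV :: nat set) \<rightarrow>\<^sub>M borel"
        by simp
      ultimately show ?thesis
        by (rule measurable_compose)
    qed
    then have "(\<lambda>p j. fst p j) \<in> N \<rightarrow>\<^sub>M PiM UNIV (\<lambda>_. borel)"
      by (intro measurable_PiM_single') auto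
    \<comment> \<open>The index set is countable and \<open>nat\<close> is second countable, so the
      Borel sets of the product space form the product sigma-algebra.\<close>
    then show ?thesis
      using measurable_cong_sets[OF refl sets_PiM_equal_borel] by auto
  qed
  have snd: "snd \<in> N \<rightarrow>\<^sub>M borel"
    unfolding borel_measurable_complex_iff borel_measurable_iff_le
    using half[OF continuous_on_Re[OF continuous_on_id] finite_circle_Re]
      half[OF continuous_on_Im[OF continuous_on_id] finite_circle_Im]
    by blast
  have "(\<lambda>p. p) \<in> N \<rightarrow>\<^sub>M borel"
    using measurable_Pair[OF fst snd] by (simp add: borel_prod)
  then have "(\<lambda>p. p) \<in> N \<rightarrow>\<^sub>M skew_borel k"
    unfolding skew_borel_def by (intro measurable_restrict_space2) (auto simp: N)
  then have "A \<in> cheap_events" if "A \<in> events" for A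
    using measurable_sets[of "\<lambda>p. p" N "skew_borel k" A] sets.sets_into_space[OF that] that
    by (simp add: N sets_M space_M Int_absorb2)
  then show "events \<subseteq> cheap_events" by blast
qed

end

theorem corollary2p6:
  fixes k :: nat
    and f :: "nat \<Rightarrow> complex \<Rightarrow> complex"
    and \<mu> :: "((int \<Rightarrow> nat) \<times> complex) measure"
  assumes "\<And>i. i \<in> {1..k} \<Longrightarrow> circle_C1_diffeo (f i)"
    and "prob_space \<mu>"
    and "sets \<mu> = sets (skew_borel k)"
    and "invariant_measure (skew_map f) \<mu>"
    and "periodic_repetitive_pattern k f \<mu>"
  shows "ks_entropy \<mu> (skew_map f) = 0"
proof -
  have space: "space \<mu> = skew_space k"
    using sets_eq_imp_space_eq[OF assms(3)] by (simp add: skew_borel_def space_restrict_space)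
  interpret prob_space \<mu> by fact
  interpret skew_product k f \<mu>
  proof
    show "skew_map f \<in> \<mu> \<rightarrow>\<^sub>M \<mu>" "distr \<mu> \<mu> (skew_map f) = \<mu>"
      using assms(4) by (simp_all only: invariant_measure_def)
    show "skew_map f ` space \<mu> = space \<mu>"
      unfolding space using assms(1) by (rule skew_map_image)
  qed fact+
  show ?thesis
    using assms(5) by (rule ks_entropy_repetitive_pattern)
qed

end
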